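(* Let $(k_n)$ be a sequence of integers with $k_n=n^{o(1)}$ and $k_n\to\infty$ as $n\to\infty$. Let $f_n$ be the indicator of the property that $\mathcal{G}(n,p)$ has a clique of size $k_n$, and suppose $p=p(n)$ is such that $(f_n)$ is nondegenerate. Then $(f_n)$ is noise sensitive. Moreover, it is 1-strongly noise sensitive.
   Context: Setting: $f_n:\Omega_n=\{0,1\}^{\Lambda_n}\to\{0,1\}$ are Boolean functions, $\Lambda_n$ finite, and $\Omega_n$ carries the product measure $\mathbb{P}$ under which the coordinates are i.i.d. Bernoulli$(p_n)$. For the random graph $\mathcal{G}(n,p)$, $\Lambda_n$ is the set of $\binom n2$ potential edges of a graph on $n$ labeled vertices and $p_n=p$; a monotone increasing graph property is identified with its indicator. The sequence is nondegenerate if $\mathbb{P}(f_n=1)$ is bounded away from $0$ and $1$ as $n\to\infty$. For $\omega\in\Omega_n$ and $\varepsilon\in(0,1)$, $\omega^\varepsilon$ is obtained from $\omega$ by independently resampling each coordinate (from Bernoulli$(p_n)$) with probability $\varepsilon$. Noise sensitive: for every fixed $\varepsilon\in(0,1)$, $\lim_{n\to\infty}\mathbb{P}(f_n(\omega^\varepsilon)=1\mid f_n(\omega)=1)-\mathbb{P}(f_n=1)=0$. A 1-witness for a monotone increasing $f$ is a minimal subset $W\subset\Lambda$ such that $\omega_W\equiv1$ implies $f(\omega)=1$; $\mathcal{W}_1(f)$ is the set of 1-witnesses. 1-strongly noise sensitive: for every fixed $\varepsilon\in(0,1)$, $\lim_{n\to\infty}\max_{W\in\mathcal{W}_1(f_n)}\mathbb{P}(f_n(\omega^\varepsilon)=1\mid\omega_W\equiv1)-\mathbb{P}(f_n=1)=0$.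 *)

theory Defs
  imports
    "HOL-Probability.Probability"
    "HOL-Probability.Product_PMF"
    "HOL-Library.Ramsey"
    "HOL-Library.Landau_Symbols"
begin

text \<open>
  A configuration \<open>\<omega>\<close> on a finite coordinate set \<open>\<Lambda>\<close> is a function into \<^typ>\<open>bool\<close> that is
  \<^const>\<open>False\<close> off \<open>\<Lambda>\<close>; \<^const>\<open>True\<close> plays the role of 1. Boolean functions \<open>f\<close> are
  predicates on configurations, and only their values on \<open>configs \<Lambda>\<close> matter.
\<close>

type_synonym 'e config = "'e \<Rightarrow> bool"

definition configs :: "'e set \<Rightarrow> 'e config set" where
  "configs \<Lambda> = PiE_dflt \<Lambda> False (\<lambda>_. UNIV)"

definition config_pmf :: "'e set \<Rightarrow> real \<Rightarrow> 'e config pmf" where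
  "config_pmf \<Lambda> p = Pi_pmf \<Lambda> False (\<lambda>_. bernoulli_pmf p)"

text \<open>
  The joint law of \<open>(\<omega>, \<omega>\<^sup>\<epsilon>)\<close>: \<open>\<rho>\<close> selects the coordinates to be resampled and \<open>\<omega>'\<close> provides the
  fresh values.
\<close>

definition resample_pmf :: "'e set \<Rightarrow> real \<Rightarrow> real \<Rightarrow> ('e config \<times> 'e config) pmf" where
  "resample_pmf \<Lambda> p \<epsilon> =
     do {
       \<omega> \<leftarrow> config_pmf \<Lambda> p;
       \<omega>' \<leftarrow> config_pmf \<Lambda> p;
       \<rho> \<leftarrow> config_pmf \<Lambda> \<epsilon>;
       return_pmf (\<omega>, \<lambda>e. if \<rho> e then \<omega>' e else \<omega> e)
     }"

definition nondegenerate ::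
    "(nat \<Rightarrow> 'e set) \<Rightarrow> (nat \<Rightarrow> real) \<Rightarrow> (nat \<Rightarrow> 'e config \<Rightarrow> bool) \<Rightarrow> bool" where
  "nondegenerate \<Lambda> p f \<longleftrightarrow>
     (\<exists>c>0. \<forall>\<^sub>F n in sequentially.
        c \<le> \<P>(\<omega> in config_pmf (\<Lambda> n) (p n). f n \<omega>) \<and>
        \<P>(\<omega> in config_pmf (\<Lambda> n) (p n). f n \<omega>) \<le> 1 - c)"

definition noise_sensitive ::
    "(nat \<Rightarrow> 'e set) \<Rightarrow> (nat \<Rightarrow> real) \<Rightarrow> (nat \<Rightarrow> 'e config \<Rightarrow> bool) \<Rightarrow> bool" where
  "noise_sensitive \<Lambda> p f \<longleftrightarrow>
     (\<forall>\<epsilon>\<in>{0<..<1}.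
        (\<lambda>n. \<P>((\<omega>, \<omega>') in resample_pmf (\<Lambda> n) (p n) \<epsilon>. f n \<omega>' \<bar> f n \<omega>)
             - \<P>(\<omega> in config_pmf (\<Lambda> n) (p n). f n \<omega>)) \<longlonglongrightarrow> 0)"

definition forces_one :: "'e set \<Rightarrow> ('e config \<Rightarrow> bool) \<Rightarrow> 'e set \<Rightarrow> bool" where
  "forces_one \<Lambda> f W \<longleftrightarrow> W \<subseteq> \<Lambda> \<and> (\<forall>\<omega>\<in>configs \<Lambda>. (\<forall>e\<in>W. \<omega> e) \<longrightarrow> f \<omega>)"

definition one_witnesses :: "'e set \<Rightarrow> ('e config \<Rightarrow> bool) \<Rightarrow> 'e set set" where
  "one_witnesses \<Lambda> f = {W. forces_one \<Lambda> f W \<and> (\<forall>V. V \<subset> W \<longrightarrow> \<not> forces_one \<Lambda> f V)}"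

text \<open>
  The maximum below is over a finite set, which is empty (and \<^const>\<open>Max\<close> then unspecified) only
  if \<open>f n\<close> never takes the value 1; under nondegeneracy this happens for at most finitely many \<open>n\<close>.
\<close>

definition one_strongly_noise_sensitive ::
    "(nat \<Rightarrow> 'e set) \<Rightarrow> (nat \<Rightarrow> real) \<Rightarrow> (nat \<Rightarrow> 'e config \<Rightarrow> bool) \<Rightarrow> bool" where
  "one_strongly_noise_sensitive \<Lambda> p f \<longleftrightarrow>
     (\<forall>\<epsilon>\<in>{0<..<1}.
        (\<lambda>n. (MAX W\<in>one_witnesses (\<Lambda> n) (f n).
                \<P>((\<omega>, \<omega>') in resample_pmf (\<Lambda> n) (p n) \<epsilon>. f n \<omega>' \<bar> \<forall>e\<in>W. \<omega> e))
             - \<P>(\<omega> in config_pmf (\<Lambda> n) (p n). f n \<omega>)) \<longlonglongrightarrow> 0)"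

definition potential_edges :: "nat \<Rightarrow> nat set set" where
  "potential_edges n = [{..<n}]\<^bsup>2\<^esup>"

text \<open>On \<open>configs (potential_edges n)\<close>, \<open>{e. \<omega> e}\<close> is the edge set of the graph \<open>\<omega>\<close>.\<close>

definition has_clique :: "nat \<Rightarrow> nat \<Rightarrow> nat set config \<Rightarrow> bool" where
  "has_clique n k \<omega> \<longleftrightarrow>
     (\<exists>S\<subseteq>{..<n}. card S = k \<and> clique S {e. \<omega> e})"

end

theory Submission
  imports Defs
begin

text \<open>
  By symmetry it is enough to plant one \<open>k\<close>-clique \<open>K\<close>. Given the planted clique, \<open>\<omega>\<^sup>\<epsilon>\<close> is again a
  product measure, with edge probability \<open>q = 1 - \<epsilon> + \<epsilon> p\<close> inside \<open>K\<close> and \<open>p\<close> elsewhere. Cliques sharing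
  at most one vertex with \<open>K\<close> do not see the planting, so the gain in probability is at most the
  expected number of cliques sharing at least two vertices with \<open>K\<close>. The contribution of \<open>K\<close> itself is
  \<open>q ^ (k choose 2)\<close>, which vanishes; the remaining terms form the overlap sum of the second moment
  method. At the density \<open>x\<close> where the expected number of cliques is \<open>M\<close>, this sum is
  \<open>O(k\<^sup>4 / sqrt n)\<close>. By Chebyshev, the probability of having no clique at density \<open>x\<close> or above is at
  most \<open>(1 + o(1)) / M\<close>, so with \<open>M = 2 / c\<close> nondegeneracy forces \<open>p < x\<close>, and all bounds are monotone in \<open>p\<close>.

  The lower bounds are instances of Harris' inequality. Noise sensitivity follows from the strong
  version by conditioning on the first clique present in a fixed ordering.
\<close>

section \<open>Inhomogeneous Bernoulli fields and noise\<close>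

text \<open>The density depends on the coordinate because planting a clique and then adding noise
  yields a product measure with two different densities.\<close>

definition bernoulli_field :: "'e set \<Rightarrow> ('e \<Rightarrow> real) \<Rightarrow> 'e config pmf" where
  "bernoulli_field \<Lambda> r = Pi_pmf \<Lambda> False (\<lambda>e. bernoulli_pmf (r e))"

abbreviation field_expectation :: "'e set \<Rightarrow> ('e \<Rightarrow> real) \<Rightarrow> ('e config \<Rightarrow> real) \<Rightarrow> real" where
  "field_expectation \<Lambda> r \<equiv> measure_pmf.expectation (bernoulli_field \<Lambda> r)"

lemma config_pmf_eq_field: "config_pmf \<Lambda> p = bernoulli_field \<Lambda> (\<lambda>_. p)"
  by (simp add: config_pmf_def bernoulli_field_def)

section \<open>Integration over a Bernoulli field, Harris' inequality and planting\<close>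

lemma bernoulli_field_cong:
  "(\<And>e. e \<in> \<Lambda> \<Longrightarrow> r e = s e) \<Longrightarrow> bernoulli_field \<Lambda> r = bernoulli_field \<Lambda> s"
  unfolding bernoulli_field_def by (intro Pi_pmf_cong) auto

lemma finite_set_field:
  assumes "finite \<Lambda>"
  shows "finite (set_pmf (bernoulli_field \<Lambda> r))"
  unfolding bernoulli_field_def set_Pi_pmf[OF assms] using assms by (intro finite_PiE_dflt) auto

lemma integrable_field [simp]:
  fixes f :: "'e config \<Rightarrow> real"
  assumes "finite \<Lambda>"
  shows "integrable (measure_pmf (bernoulli_field \<Lambda> r)) f"
  by (intro integrable_measure_pmf_finite finite_set_field assms)

lemma field_expectation_mono:
  assumes "finite \<Lambda>" "\<And>\<omega>. f \<omega> \<le> g \<omega>"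
  shows "field_expectation \<Lambda> r f \<le> field_expectation \<Lambda> r g"
  using assms by (intro integral_mono) auto

text \<open>Fubini in the coordinate \<open>e\<close>. This recursion drives the inductions in
  \<open>harris_inequality\<close> and \<open>field_expectation_condition\<close>.\<close>

lemma field_expectation_insert:
  assumes fin: "finite \<Lambda>" and e: "e \<notin> \<Lambda>" and r: "r e \<in> {0..1}"
  shows "field_expectation (insert e \<Lambda>) r f =
    r e * field_expectation \<Lambda> r (\<lambda>\<omega>. f ((\<omega>)(e := True))) +
    (1 - r e) * field_expectation \<Lambda> r (\<lambda>\<omega>. f ((\<omega>)(e := False)))"
proof -
  have eq: "bernoulli_field (insert e \<Lambda>) r =
     bernoulli_pmf (r e) \<bind> (\<lambda>b. map_pmf (\<lambda>\<omega>. (\<omega>)(e := b)) (bernoulli_field \<Lambda> r))"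
    unfolding bernoulli_field_def Pi_pmf_insert'[OF fin e]
    by (simp add: map_pmf_def)
  have "field_expectation (insert e \<Lambda>) r f =
     measure_pmf.expectation (bernoulli_pmf (r e))
       (\<lambda>b. field_expectation \<Lambda> r (\<lambda>\<omega>. f ((\<omega>)(e := b))))"
    unfolding eq using finite_set_field[OF fin]
    by (subst pmf_expectation_bind[of UNIV])
      (auto simp: integral_measure_pmf_real[of UNIV] mult.commute)
  also have "\<dots> = r e * field_expectation \<Lambda> r (\<lambda>\<omega>. f ((\<omega>)(e := True))) +
    (1 - r e) * field_expectation \<Lambda> r (\<lambda>\<omega>. f ((\<omega>)(e := False)))"
    using r by (subst integral_bernoulli_pmf) auto
  finally show ?thesis .
qed

text \<open>Coordinates are revealed one at a time. The induction hypothesis treats the two sections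
  at \<open>e\<close>; their means are ordered by monotonicity and are combined by the inequality
  for a single coordinate.\<close>

theorem harris_inequality:
  fixes f g :: "'e config \<Rightarrow> real"
  assumes fin: "finite \<Lambda>" and r: "\<And>e. e \<in> \<Lambda> \<Longrightarrow> r e \<in> {0..1}"
    and "mono f" "mono g"
  shows "field_expectation \<Lambda> r f * field_expectation \<Lambda> r g \<le>
         field_expectation \<Lambda> r (\<lambda>\<omega>. f \<omega> * g \<omega>)"
  using assms
proof (induction \<Lambda> arbitrary: f g rule: finite_induct)
  case empty
  then show ?case by (simp add: bernoulli_field_def)
next
  case (insert e \<Lambda>)
  let ?E = "field_expectation \<Lambda> r"
  let ?f = "\<lambda>b \<omega>. f ((\<omega>)(e := b))" and ?g = "\<lambda>b \<omega>. g ((\<omega>)(e := b))"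
  have mono: "mono (?f b)" "mono (?g b)" for b
    using \<open>mono f\<close> \<open>mono g\<close> by (auto intro!: monoI elim!: monoD simp: le_fun_def)
  have IH: "?E (?f b) * ?E (?g b) \<le> ?E (\<lambda>\<omega>. ?f b \<omega> * ?g b \<omega>)" for b
    using insert.prems by (intro insert.IH mono) auto
  have re: "0 \<le> r e" "r e \<le> 1" using insert.prems by auto
  have le: "?E (?f False) \<le> ?E (?f True)" "?E (?g False) \<le> ?E (?g True)"
    using insert.hyps \<open>mono f\<close> \<open>mono g\<close>
    by (auto intro!: field_expectation_mono elim!: monoD simp: le_fun_def)
  \<comment> \<open>Harris for one coordinate: the covariance of two functions of a Bernoulli
    variable is \<open>t * (1 - t)\<close> times the product of their increments.\<close>
  have conv: "(t * a + (1 - t) * c) * (t * b + (1 - t) * d) \<le> t * (a * b) + (1 - t) * (c * d)"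
    if "0 \<le> t" "t \<le> 1" "c \<le> a" "d \<le> b" for t a b c d :: real
  proof -
    have "t * (a * b) + (1 - t) * (c * d) - (t * a + (1 - t) * c) * (t * b + (1 - t) * d)
        = t * (1 - t) * ((a - c) * (b - d))"
      by (simp add: algebra_simps)
    also have "\<dots> \<ge> 0" using that by simp
    finally show ?thesis by simp
  qed
  have "field_expectation (insert e \<Lambda>) r f * field_expectation (insert e \<Lambda>) r g
      \<le> r e * (?E (?f True) * ?E (?g True)) + (1 - r e) * (?E (?f False) * ?E (?g False))"
    using re le insert.hyps by (simp add: field_expectation_insert conv)
  also have "\<dots> \<le> r e * ?E (\<lambda>\<omega>. ?f True \<omega> * ?g True \<omega>)
      + (1 - r e) * ?E (\<lambda>\<omega>. ?f False \<omega> * ?g False \<omega>)"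
    using re IH by (intro add_mono mult_left_mono) auto
  also have "\<dots> = field_expectation (insert e \<Lambda>) r (\<lambda>\<omega>. f \<omega> * g \<omega>)"
    using re insert.hyps by (simp add: field_expectation_insert)
  finally show ?case .
qed

text \<open>
  Conditioning on \<open>\<omega>\<^sub>W \<equiv> 1\<close> is encoded as moving the success probabilities on \<open>W\<close> to 1, which
  stays meaningful when the event has probability 0.
\<close>

definition plant :: "'e set \<Rightarrow> ('e \<Rightarrow> real) \<Rightarrow> 'e \<Rightarrow> real" where
  "plant W r e = (if e \<in> W then 1 else r e)"

text \<open>Each coordinate of \<open>W\<close> whose density is moved to 1 releases its old density
  as a factor.\<close>

lemma field_expectation_condition:
  assumes fin: "finite \<Lambda>" and W: "W \<subseteq> \<Lambda>" and r: "\<And>e. e \<in> \<Lambda> \<Longrightarrow> r e \<in> {0..1}"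
  shows "field_expectation \<Lambda> r (\<lambda>\<omega>. of_bool (\<forall>e\<in>W. \<omega> e) * h \<omega>) =
         (\<Prod>e\<in>W. r e) * field_expectation \<Lambda> (plant W r) h"
proof -
  have "finite W" using fin W finite_subset by auto
  then show ?thesis using W
  proof (induction W arbitrary: h rule: finite_induct)
    case empty
    then show ?case by (simp add: plant_def[abs_def])
  next
    case (insert e W)
    define \<Lambda>' where "\<Lambda>' = \<Lambda> - {e}"
    have \<Lambda>: "\<Lambda> = insert e \<Lambda>'" "e \<notin> \<Lambda>'" "finite \<Lambda>'" using insert.prems fin by (auto simp: \<Lambda>'_def)
    have pe: "plant W r e = r e" using insert.hyps by (simp add: plant_def)
    have re: "r e \<in> {0..1}" using r insert.prems by auto
    have "field_expectation \<Lambda> r (\<lambda>\<omega>. of_bool (\<forall>e\<in>insert e W. \<omega> e) * h \<omega>)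
      = field_expectation \<Lambda> r (\<lambda>\<omega>. of_bool (\<forall>e\<in>W. \<omega> e) * (of_bool (\<omega> e) * h \<omega>))"
      by (intro Bochner_Integration.integral_cong) auto
    also have "\<dots> = (\<Prod>e\<in>W. r e) *
        field_expectation \<Lambda> (plant W r) (\<lambda>\<omega>. of_bool (\<omega> e) * h \<omega>)"
      using insert.prems by (intro insert.IH) auto
    \<comment> \<open>\<open>e\<close> lies outside \<open>W\<close>, so its density is still
      \<open>r e\<close>; the indicator kills the branch in which \<open>e\<close> is
      \<open>False\<close>.\<close>
    also have "field_expectation \<Lambda> (plant W r) (\<lambda>\<omega>. of_bool (\<omega> e) * h \<omega>)
      = r e * field_expectation \<Lambda>' (plant W r) (\<lambda>\<omega>. h ((\<omega>)(e := True)))"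
      unfolding \<Lambda>(1) using \<Lambda> re pe by (subst field_expectation_insert) auto
    also have "field_expectation \<Lambda>' (plant W r) (\<lambda>\<omega>. h ((\<omega>)(e := True)))
      = field_expectation \<Lambda>' (plant (insert e W) r) (\<lambda>\<omega>. h ((\<omega>)(e := True)))"
      using \<Lambda>(2) by (subst bernoulli_field_cong[of _ _ "plant (insert e W) r"]) (auto simp: plant_def)
    \<comment> \<open>The density at \<open>e\<close> is now 1, so putting \<open>e\<close> back
      costs no factor.\<close>
    also have "\<dots> = field_expectation \<Lambda> (plant (insert e W) r) h"
      unfolding \<Lambda>(1) using \<Lambda> re by (subst field_expectation_insert) (auto simp: plant_def)
    finally show ?case using insert.hyps by simp
  qed
qed

lemma field_expectation_all:
  assumes "finite \<Lambda>" "W \<subseteq> \<Lambda>" "\<And>e. e \<in> \<Lambda> \<Longrightarrow> r e \<in> {0..1}"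
  shows "field_expectation \<Lambda> r (\<lambda>\<omega>. of_bool (\<forall>e\<in>W. \<omega> e)) = (\<Prod>e\<in>W. r e)"
  using field_expectation_condition[OF assms, where h = "\<lambda>_. 1"] by simp

lemma field_prob:
  "\<P>(\<omega> in bernoulli_field \<Lambda> r. P \<omega>) = field_expectation \<Lambda> r (\<lambda>\<omega>. of_bool (P \<omega>))"
proof -
  have "(\<lambda>\<omega>. of_bool (P \<omega>)) = (indicator {\<omega>. P \<omega>} :: _ \<Rightarrow> real)" by (auto simp: indicator_def)
  then show ?thesis by simp
qed

text \<open>The hypothesis on \<open>h\<close> says that it ignores \<open>W\<close>: clearing these
  coordinates changes nothing. Both expectations therefore reduce to the common marginal on
  \<open>\<Lambda> - W\<close>.\<close>

lemma field_expectation_local: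
  fixes h :: "'e config \<Rightarrow> real"
  assumes fin: "finite \<Lambda>" and eq: "\<And>e. e \<in> \<Lambda> - W \<Longrightarrow> r e = s e"
    and h: "\<And>\<omega>. h (\<lambda>e. e \<notin> W \<and> \<omega> e) = h \<omega>"
  shows "field_expectation \<Lambda> r h = field_expectation \<Lambda> s h"
proof -
  have *: "field_expectation \<Lambda> t h = field_expectation (\<Lambda> - W) t h" for t
  proof -
    have "bernoulli_field (\<Lambda> - W) t =
        map_pmf (\<lambda>\<omega> e. if e \<in> \<Lambda> - W then \<omega> e else False) (bernoulli_field \<Lambda> t)"
      unfolding bernoulli_field_def by (intro Pi_pmf_subset fin) auto
    then have "field_expectation (\<Lambda> - W) t h =
        field_expectation \<Lambda> t (\<lambda>\<omega>. h (\<lambda>e. if e \<in> \<Lambda> - W then \<omega> e else False))"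
      by simp
    also have "\<dots> = field_expectation \<Lambda> t h"
    proof (intro integral_cong_AE AE_pmfI)
      fix \<omega> assume "\<omega> \<in> set_pmf (bernoulli_field \<Lambda> t)"
      \<comment> \<open>This equality uses the support: there \<open>\<omega>\<close> is
        \<open>False\<close> off \<open>\<Lambda>\<close>.\<close>
      then have "(\<lambda>e. if e \<in> \<Lambda> - W then \<omega> e else False) = (\<lambda>e. e \<notin> W \<and> \<omega> e)"
        using set_Pi_pmf_subset[OF fin] unfolding bernoulli_field_def by fastforce
      then show "h (\<lambda>e. if e \<in> \<Lambda> - W then \<omega> e else False) = h \<omega>"
        using h by simp
    qed auto
    finally show ?thesis by simp
  qed
  show ?thesis unfolding * by (subst bernoulli_field_cong[of _ _ s]) (use eq in auto)
qed

section \<open>The noise operator and its action on product measures\<close>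

definition noise_operator ::
    "'e set \<Rightarrow> real \<Rightarrow> real \<Rightarrow> ('e config \<Rightarrow> real) \<Rightarrow> 'e config \<Rightarrow> real" where
  "noise_operator \<Lambda> p \<epsilon> f \<omega> =
     field_expectation \<Lambda> (\<lambda>_. p) (\<lambda>\<omega>'.
       field_expectation \<Lambda> (\<lambda>_. \<epsilon>) (\<lambda>\<rho>. f (\<lambda>e. if \<rho> e then \<omega>' e else \<omega> e)))"

lemma mono_noise_operator:
  assumes "finite \<Lambda>" "mono f"
  shows "mono (noise_operator \<Lambda> p \<epsilon> f)"
  unfolding noise_operator_def using assms
  by (intro monoI field_expectation_mono) (auto elim!: monoD simp: le_fun_def)

lemma field_bind_expectation:
  fixes h :: "'b \<Rightarrow> real"
  assumes fin: "finite \<Lambda>" and "\<And>\<omega>. finite (set_pmf (N \<omega>))"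
  shows "measure_pmf.expectation (bernoulli_field \<Lambda> r \<bind> N) h =
         field_expectation \<Lambda> r (\<lambda>\<omega>. measure_pmf.expectation (N \<omega>) h)"
proof -
  have "measure_pmf.expectation (bernoulli_field \<Lambda> r \<bind> N) h =
     (\<Sum>a\<in>set_pmf (bernoulli_field \<Lambda> r). pmf (bernoulli_field \<Lambda> r) a *\<^sub>R measure_pmf.expectation (N a) h)"
    using assms finite_set_field[OF fin] by (intro pmf_expectation_bind) auto
  also have "\<dots> = field_expectation \<Lambda> r (\<lambda>\<omega>. measure_pmf.expectation (N \<omega>) h)"
    by (subst integral_measure_pmf_real[OF finite_set_field[OF fin]]) (auto simp: mult.commute)
  finally show ?thesis .
qed

text \<open>Tower property: \<open>noise_operator\<close> is the conditional mean of
  \<open>f\<close> at \<open>\<omega>\<^sup>\<epsilon>\<close> given \<open>\<omega>\<close>.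
  Correlations under noise thus become integrals over a single field.\<close>

lemma resample_expectation:
  fixes f g :: "'e config \<Rightarrow> real"
  assumes fin: "finite \<Lambda>"
  shows "measure_pmf.expectation (resample_pmf \<Lambda> p \<epsilon>) (\<lambda>(\<omega>, \<omega>'). g \<omega> * f \<omega>') =
         field_expectation \<Lambda> (\<lambda>_. p) (\<lambda>\<omega>. g \<omega> * noise_operator \<Lambda> p \<epsilon> f \<omega>)"
  unfolding resample_pmf_def config_pmf_eq_field noise_operator_def
  by (simp add: field_bind_expectation fin finite_set_field)

lemma bernoulli_resample:
  assumes "a \<in> {0..1}" "p \<in> {0..1}" "\<epsilon> \<in> {0..1}"
  shows "bernoulli_pmf ((1 - \<epsilon>) * a + \<epsilon> * p) =
    do {x \<leftarrow> bernoulli_pmf a; y \<leftarrow> bernoulli_pmf p; z \<leftarrow> bernoulli_pmf \<epsilon>;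
        return_pmf (if z then y else x)}"
proof (rule pmf_eqI)
  fix b
  \<comment> \<open>\<open>bernoulli_pmf\<close> clips parameters outside the unit interval, so
    membership is settled before its mass function is evaluated.\<close>
  have "0 \<le> (1 - \<epsilon>) * a + \<epsilon> * p" using assms by auto
  moreover have "(1 - \<epsilon>) * a + \<epsilon> * p \<le> 1" using assms by (intro convex_bound_le) auto
  ultimately show "pmf (bernoulli_pmf ((1 - \<epsilon>) * a + \<epsilon> * p)) b = pmf (do {x \<leftarrow> bernoulli_pmf a; y \<leftarrow> bernoulli_pmf p; z \<leftarrow> bernoulli_pmf \<epsilon>;
        return_pmf (if z then y else x)}) b"
    using assms by (cases b) (simp_all add: pmf_bind algebra_simps)
qed

text \<open>Noise acts independently on the coordinates, so a product measure stays a product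
  measure and only its densities move. Since \<open>r\<close> may differ from \<open>p\<close>, this
  covers a planted field whose fresh values have density \<open>p\<close>.\<close>

lemma field_expectation_noise:
  assumes fin: "finite \<Lambda>" and r: "\<And>e. e \<in> \<Lambda> \<Longrightarrow> r e \<in> {0..1}" and p: "p \<in> {0..1}" and \<epsilon>: "\<epsilon> \<in> {0..1}"
  shows "field_expectation \<Lambda> r (noise_operator \<Lambda> p \<epsilon> f) =
         field_expectation \<Lambda> (\<lambda>e. (1 - \<epsilon>) * r e + \<epsilon> * p) f"
proof -
  have "bernoulli_field \<Lambda> (\<lambda>e. (1 - \<epsilon>) * r e + \<epsilon> * p) =
    Pi_pmf \<Lambda> False (\<lambda>e. do {x \<leftarrow> bernoulli_pmf (r e); y \<leftarrow> bernoulli_pmf p; z \<leftarrow> bernoulli_pmf \<epsilon>;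
        return_pmf (if z then y else x)})"
    unfolding bernoulli_field_def using r p \<epsilon> by (intro Pi_pmf_cong bernoulli_resample) auto
  also have "\<dots> = do {\<omega> \<leftarrow> bernoulli_field \<Lambda> r; \<omega>' \<leftarrow> bernoulli_field \<Lambda> (\<lambda>_. p);
       \<rho> \<leftarrow> bernoulli_field \<Lambda> (\<lambda>_. \<epsilon>); return_pmf (\<lambda>e. if e \<in> \<Lambda> then if \<rho> e then \<omega>' e else \<omega> e else False)}"
    unfolding bernoulli_field_def
    by (simp add: Pi_pmf_bind[OF fin, where d' = False] fin)
  also have "\<dots> = do {\<omega> \<leftarrow> bernoulli_field \<Lambda> r; \<omega>' \<leftarrow> bernoulli_field \<Lambda> (\<lambda>_. p);
       \<rho> \<leftarrow> bernoulli_field \<Lambda> (\<lambda>_. \<epsilon>); return_pmf (\<lambda>e. if \<rho> e then \<omega>' e else \<omega> e)}"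
  proof (intro bind_pmf_cong refl, rule arg_cong[where f = return_pmf], rule ext)
    fix \<omega> \<omega>' \<rho> e
    assume "\<omega> \<in> set_pmf (bernoulli_field \<Lambda> r)" "\<omega>' \<in> set_pmf (bernoulli_field \<Lambda> (\<lambda>_. p))"
      "\<rho> \<in> set_pmf (bernoulli_field \<Lambda> (\<lambda>_. \<epsilon>))"
    then have "e \<notin> \<Lambda> \<Longrightarrow> \<not> \<omega> e" "e \<notin> \<Lambda> \<Longrightarrow> \<not> \<omega>' e"
      using set_Pi_pmf_subset[OF fin] unfolding bernoulli_field_def by fastforce+
    then show "(if e \<in> \<Lambda> then if \<rho> e then \<omega>' e else \<omega> e else False) = (if \<rho> e then \<omega>' e else \<omega> e)"
      by auto
  qed
  finally show ?thesis
    by (simp add: noise_operator_def[abs_def] field_bind_expectation fin finite_set_field)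
qed

text \<open>
  Order the sets \<open>W\<close> in \<open>\<W>\<close> and split according to the first \<open>W\<close> with \<open>\<omega>\<^sub>W \<equiv> 1\<close>. Given
  \<open>\<omega>\<^sub>W \<equiv> 1\<close>, that no earlier set is all-one is a decreasing event, so by Harris it only
  decreases the mean of the increasing \<open>g\<close>.
\<close>
lemma field_expectation_first_witness:
  fixes g :: "'e config \<Rightarrow> real"
  assumes fin: "finite \<Lambda>" and r: "\<And>e. e \<in> \<Lambda> \<Longrightarrow> r e \<in> {0..1}" and "finite \<W>"
    and "\<And>W. W \<in> \<W> \<Longrightarrow> W \<subseteq> \<Lambda>" and g: "mono g"
    and "\<And>W. W \<in> \<W> \<Longrightarrow> field_expectation \<Lambda> (plant W r) g \<le> m"
  shows "field_expectation \<Lambda> r (\<lambda>\<omega>. of_bool (\<exists>W\<in>\<W>. \<forall>e\<in>W. \<omega> e) * g \<omega>) \<le>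
         m * field_expectation \<Lambda> r (\<lambda>\<omega>. of_bool (\<exists>W\<in>\<W>. \<forall>e\<in>W. \<omega> e))"
  using assms(3,4,6)
proof (induction \<W> rule: finite_induct)
  case empty
  then show ?case by simp
next
  case (insert W \<W>)
  let ?E = "field_expectation \<Lambda> r" and ?EW = "field_expectation \<Lambda> (plant W r)"
  let ?U = "\<lambda>\<omega>. of_bool (\<exists>W\<in>\<W>. \<forall>e\<in>W. \<omega> e) :: real"
  let ?V = "\<lambda>\<omega>. of_bool (\<exists>W\<in>insert W \<W>. \<forall>e\<in>W. \<omega> e) :: real"
  let ?I = "\<lambda>\<omega>. of_bool (\<forall>e\<in>W. \<omega> e) :: real"
  \<comment> \<open>The newly inserted \<open>W\<close> comes last in the ordering: the extra term
    lives where \<open>W\<close> is all one and no set of \<open>\<W>\<close> is.\<close>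
  have split: "?E (\<lambda>\<omega>. ?V \<omega> * h \<omega>) = ?E (\<lambda>\<omega>. ?U \<omega> * h \<omega>) + ?E (\<lambda>\<omega>. ?I \<omega> * ((1 - ?U \<omega>) * h \<omega>))" for h
  proof -
    have "?V \<omega> * h \<omega> = ?U \<omega> * h \<omega> + ?I \<omega> * ((1 - ?U \<omega>) * h \<omega>)" for \<omega>
      by (cases "\<forall>e\<in>W. \<omega> e"; cases "\<exists>W\<in>\<W>. \<forall>e\<in>W. \<omega> e") simp_all
    then show ?thesis
      using fin by (simp only:) (intro Bochner_Integration.integral_add integrable_field)
  qed
  have W: "W \<subseteq> \<Lambda>" using insert.prems by auto
  have pr: "\<And>e. e \<in> \<Lambda> \<Longrightarrow> plant W r e \<in> {0..1}" using r by (auto simp: plant_def)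
  have monoU: "mono ?U"
  proof (rule monoI)
    fix \<omega> \<omega>' :: "'e config" assume "\<omega> \<le> \<omega>'"
    then have "\<omega> e \<Longrightarrow> \<omega>' e" for e by (auto simp: le_fun_def)
    then show "?U \<omega> \<le> ?U \<omega>'" by (simp add: of_bool_def) blast
  qed
  have "?EW (\<lambda>\<omega>. (1 - ?U \<omega>) * g \<omega>) = ?EW g - ?EW (\<lambda>\<omega>. ?U \<omega> * g \<omega>)"
    using fin by (subst Bochner_Integration.integral_diff[symmetric]) (auto simp: algebra_simps)
  also have "\<dots> \<le> ?EW g - ?EW ?U * ?EW g"
    using harris_inequality[OF fin pr monoU g] by simp
  also have "\<dots> = ?EW (\<lambda>\<omega>. 1 - ?U \<omega>) * ?EW g"
    using fin by (simp add: Bochner_Integration.integral_diff algebra_simps)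
  also have "\<dots> \<le> ?EW (\<lambda>\<omega>. 1 - ?U \<omega>) * m"
    using insert.prems by (intro mult_left_mono integral_nonneg) auto
  finally have *: "?EW (\<lambda>\<omega>. (1 - ?U \<omega>) * g \<omega>) \<le> m * ?EW (\<lambda>\<omega>. 1 - ?U \<omega>)"
    by (simp add: mult.commute)
  have "0 \<le> (\<Prod>e\<in>W. r e)" using r W by (intro prod_nonneg) auto
  note cond = field_expectation_condition[OF fin W r]
  have "?E (\<lambda>\<omega>. ?I \<omega> * ((1 - ?U \<omega>) * g \<omega>)) = (\<Prod>e\<in>W. r e) * ?EW (\<lambda>\<omega>. (1 - ?U \<omega>) * g \<omega>)"
    by (rule cond)
  also have "\<dots> \<le> (\<Prod>e\<in>W. r e) * (m * ?EW (\<lambda>\<omega>. 1 - ?U \<omega>))"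
    using * by (rule mult_left_mono) fact
  also have "\<dots> = m * ((\<Prod>e\<in>W. r e) * ?EW (\<lambda>\<omega>. 1 - ?U \<omega>))"
    by (rule mult.left_commute)
  also have "(\<Prod>e\<in>W. r e) * ?EW (\<lambda>\<omega>. 1 - ?U \<omega>) = ?E (\<lambda>\<omega>. ?I \<omega> * (1 - ?U \<omega>))"
    by (rule cond[symmetric])
  finally have "?E (\<lambda>\<omega>. ?I \<omega> * ((1 - ?U \<omega>) * g \<omega>)) \<le> m * ?E (\<lambda>\<omega>. ?I \<omega> * (1 - ?U \<omega>))" .
  moreover have "?E (\<lambda>\<omega>. ?U \<omega> * g \<omega>) \<le> m * ?E ?U"
    using insert.prems by (intro insert.IH) auto
  \<comment> \<open>Taking \<open>h = 1\<close> in \<open>split\<close> decomposes the probability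
    on the right-hand side in the same way.\<close>
  ultimately show ?case
    using split[of g] split[of "\<lambda>_. 1"] by (simp add: distrib_left)
qed

section \<open>Conditional probabilities under resampling\<close>

lemma resample_cond_prob:
  fixes F Q :: "'e config \<Rightarrow> bool"
  assumes fin: "finite \<Lambda>"
  shows "\<P>((\<omega>, \<omega>') in resample_pmf \<Lambda> p \<epsilon>. F \<omega>' \<bar> Q \<omega>) =
    field_expectation \<Lambda> (\<lambda>_. p) (\<lambda>\<omega>. of_bool (Q \<omega>) * noise_operator \<Lambda> p \<epsilon> (\<lambda>\<omega>. of_bool (F \<omega>)) \<omega>) /
    field_expectation \<Lambda> (\<lambda>_. p) (\<lambda>\<omega>. of_bool (Q \<omega>))"
proof -
  let ?M = "resample_pmf \<Lambda> p \<epsilon>"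
  have pr: "measure_pmf.prob M {x. R x} = measure_pmf.expectation M (\<lambda>x. of_bool (R x))"
    for M :: "('e config \<times> 'e config) pmf" and R
  proof -
    have "(\<lambda>x. of_bool (R x)) = (indicator {x. R x} :: _ \<Rightarrow> real)" by (auto simp: indicator_def)
    then show ?thesis by simp
  qed
  have "measure_pmf.prob ?M {x. (case x of (\<omega>, \<omega>') \<Rightarrow> F \<omega>') \<and> (case x of (\<omega>, \<omega>') \<Rightarrow> Q \<omega>)} =
    measure_pmf.expectation ?M (\<lambda>(\<omega>, \<omega>'). of_bool (Q \<omega>) * of_bool (F \<omega>'))"
    unfolding pr by (intro Bochner_Integration.integral_cong) auto
  \<comment> \<open>The factor 1 makes the denominator another instance of
    \<open>resample_expectation\<close>, with constant second function.\<close>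
  moreover have "measure_pmf.prob ?M {x. case x of (\<omega>, \<omega>') \<Rightarrow> Q \<omega>} =
    measure_pmf.expectation ?M (\<lambda>(\<omega>, \<omega>'). of_bool (Q \<omega>) * 1)"
    unfolding pr by (intro Bochner_Integration.integral_cong) auto
  ultimately show ?thesis
    unfolding cond_prob_def resample_expectation[OF fin]
    by (simp add: noise_operator_def)
qed

text \<open>The constant density \<open>p\<close> is a fixed point of the density map in
  \<open>field_expectation_noise\<close>.\<close>

lemma field_expectation_noise_invariant:
  assumes "finite \<Lambda>" "p \<in> {0..1}" "\<epsilon> \<in> {0..1}"
  shows "field_expectation \<Lambda> (\<lambda>_. p) (noise_operator \<Lambda> p \<epsilon> f) = field_expectation \<Lambda> (\<lambda>_. p) f"
  using field_expectation_noise[OF assms(1), of "\<lambda>_. p" p \<epsilon> f] assms by (simp add: algebra_simps)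

text \<open>Harris applied to \<open>g\<close> and the noised \<open>f\<close>, which is again
  increasing and has the mean of \<open>f\<close>. All lower bounds on conditional probabilities
  come from here.\<close>

lemma noise_correlation_ge:
  assumes fin: "finite \<Lambda>" and p: "p \<in> {0..1}" and \<epsilon>: "\<epsilon> \<in> {0..1}" and "mono f" "mono g"
  shows "field_expectation \<Lambda> (\<lambda>_. p) g * field_expectation \<Lambda> (\<lambda>_. p) f \<le>
         field_expectation \<Lambda> (\<lambda>_. p) (\<lambda>\<omega>. g \<omega> * noise_operator \<Lambda> p \<epsilon> f \<omega>)"
  using harris_inequality[OF fin, of "\<lambda>_. p" g "noise_operator \<Lambda> p \<epsilon> f"]
    mono_noise_operator[OF fin \<open>mono f\<close>] assms field_expectation_noise_invariant[OF fin p \<epsilon>, of f]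
  by simp

section \<open>First and second moments of the number of cliques\<close>

text \<open>Writing the event as "some set of a finite family is all one" makes it fit
  \<open>field_expectation_first_witness\<close> and the moment computations.\<close>

lemma has_clique_iff:
  "has_clique n k \<omega> \<longleftrightarrow> (\<exists>S\<in>[{..<n}]\<^bsup>k\<^esup>. \<forall>e\<in>[S]\<^bsup>2\<^esup>. \<omega> e)"
proof -
  have "clique S {e. \<omega> e} \<longleftrightarrow> (\<forall>e\<in>[S]\<^bsup>2\<^esup>. \<omega> e)" for S
    unfolding clique_def by (auto elim!: nsets2_E)
  moreover have "S \<in> [{..<n}]\<^bsup>k\<^esup> \<longleftrightarrow> S \<subseteq> {..<n} \<and> card S = k" for S
    by (auto simp: nsets_def finite_subset)
  ultimately show ?thesis unfolding has_clique_def by blast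
qed

lemma has_clique_mono: "has_clique n k \<omega> \<Longrightarrow> \<omega> \<le> \<omega>' \<Longrightarrow> has_clique n k \<omega>'"
  unfolding has_clique_iff by (auto simp: le_fun_def)

lemma mono_of_bool_has_clique: "mono (\<lambda>\<omega>. of_bool (has_clique n k \<omega>) :: real)"
  using has_clique_mono by (intro monoI) (auto simp: of_bool_def)

lemma finite_potential_edges [simp]: "finite (potential_edges n)"
  by (simp add: potential_edges_def finite_imp_finite_nsets)

lemma nsets_subset_potential_edges: "S \<in> [{..<n}]\<^bsup>k\<^esup> \<Longrightarrow> [S]\<^bsup>2\<^esup> \<subseteq> potential_edges n"
  unfolding potential_edges_def by (intro nsets_mono) (auto simp: nsets_def)

section \<open>Counting cliques by their overlap with a fixed vertex set\<close>

lemma nsets_Int: "[S]\<^bsup>j\<^esup> \<inter> [T]\<^bsup>j\<^esup> = [S \<inter> T]\<^bsup>j\<^esup>"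
  by (auto simp: nsets_def)

text \<open>\<open>S\<close> is determined by its parts inside and outside \<open>K\<close>, which
  are counted separately.\<close>

lemma card_overlap_le:
  assumes V: "finite V" and K: "K \<subseteq> V"
  shows "card {S \<in> [V]\<^bsup>k\<^esup>. card (S \<inter> K) = l} \<le> (card K choose l) * ((card V - card K) choose (k - l))"
proof -
  have fK: "finite K" using V K finite_subset by auto
  have "card {S \<in> [V]\<^bsup>k\<^esup>. card (S \<inter> K) = l} \<le> card ([K]\<^bsup>l\<^esup> \<times> [V - K]\<^bsup>(k - l)\<^esup>)"
  proof (rule card_inj_on_le[of "\<lambda>S. (S \<inter> K, S - K)"])
    show "inj_on (\<lambda>S. (S \<inter> K, S - K)) {S \<in> [V]\<^bsup>k\<^esup>. card (S \<inter> K) = l}"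
      by (rule inj_onI) blast
    show "(\<lambda>S. (S \<inter> K, S - K)) ` {S \<in> [V]\<^bsup>k\<^esup>. card (S \<inter> K) = l} \<subseteq> [K]\<^bsup>l\<^esup> \<times> [V - K]\<^bsup>(k - l)\<^esup>"
      by (auto simp: nsets_def card_Diff_subset_Int)
    show "finite ([K]\<^bsup>l\<^esup> \<times> [V - K]\<^bsup>(k - l)\<^esup>)"
      using V fK by (simp add: finite_imp_finite_nsets)
  qed
  also have "\<dots> = (card K choose l) * ((card V - card K) choose (k - l))"
    using fK K by (simp add: card_cartesian_product card_Diff_subset)
  finally show ?thesis .
qed

text \<open>Grouping by overlap size. Overlaps start at 2 because two vertex sets meeting in at most
  one vertex share no edge.\<close>

lemma sum_overlap_le:
  fixes F :: "nat \<Rightarrow> real"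
  assumes K: "K \<in> [{..<n}]\<^bsup>k\<^esup>" and F: "\<And>l. 0 \<le> F l"
  shows "(\<Sum>S\<in>{S \<in> [{..<n}]\<^bsup>k\<^esup>. 2 \<le> card (S \<inter> K)}. F (card (S \<inter> K))) \<le>
         (\<Sum>l\<in>{2..k}. real ((k choose l) * ((n - k) choose (k - l))) * F l)"
proof -
  have K': "K \<subseteq> {..<n}" "card K = k" "finite K" using K by (auto simp: nsets_def)
  let ?A = "{S \<in> [{..<n}]\<^bsup>k\<^esup>. 2 \<le> card (S \<inter> K)}"
  have "(\<Sum>S\<in>?A. F (card (S \<inter> K))) = (\<Sum>l\<in>{2..k}. \<Sum>S\<in>{S \<in> ?A. card (S \<inter> K) = l}. F (card (S \<inter> K)))"
  proof (rule sum.group[symmetric])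
    show "finite ?A" by (simp add: finite_imp_finite_nsets)
    show "(\<lambda>S. card (S \<inter> K)) ` ?A \<subseteq> {2..k}"
      using K' by (auto intro: order_trans[OF card_mono[of K]])
  qed auto
  also have "\<dots> \<le> (\<Sum>l\<in>{2..k}. real ((k choose l) * ((n - k) choose (k - l))) * F l)"
  proof (rule sum_mono)
    fix l assume "l \<in> {2..k}"
    then have eq: "{S \<in> ?A. card (S \<inter> K) = l} = {S \<in> [{..<n}]\<^bsup>k\<^esup>. card (S \<inter> K) = l}" by auto
    have "(\<Sum>S\<in>{S \<in> ?A. card (S \<inter> K) = l}. F (card (S \<inter> K))) = real (card {S \<in> [{..<n}]\<^bsup>k\<^esup>. card (S \<inter> K) = l}) * F l"
      unfolding eq by simp
    also have "\<dots> \<le> real ((k choose l) * ((n - k) choose (k - l))) * F l"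
      using card_overlap_le[OF _ K'(1), of k l] K' F by (intro mult_right_mono) (auto simp del: of_nat_mult)
    finally show "(\<Sum>S\<in>{S \<in> ?A. card (S \<inter> K) = l}. F (card (S \<inter> K))) \<le>
      real ((k choose l) * ((n - k) choose (k - l))) * F l" .
  qed
  finally show ?thesis .
qed

text \<open>With a \<open>k\<close>-clique planted at edge density 1 in a graph of density
  \<open>x\<close>, this is the expected number of other \<open>k\<close>-cliques sharing an edge
  with it. The planted clique, \<open>l = k\<close>, is left out since its term is treated
  separately: it is a power of the noisy density in one application and 1 in the other.\<close>

definition overlap_sum :: "nat \<Rightarrow> nat \<Rightarrow> real \<Rightarrow> real" where
  "overlap_sum n k x = (\<Sum>l\<in>{2..<k}. real ((k choose l) * ((n - k) choose (k - l))) *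
     x ^ ((k choose 2) - (l choose 2)))"

lemma binomial_mono_left: "l \<le> k \<Longrightarrow> l choose m \<le> k choose m"
  using card_mono[OF finite_imp_finite_nsets[of "{..<k}" m] nsets_mono[of "{..<l}" "{..<k}" m]]
  by simp

lemma overlap_sum_mono:
  "0 \<le> p \<Longrightarrow> p \<le> x \<Longrightarrow> overlap_sum n k p \<le> overlap_sum n k x"
  unfolding overlap_sum_def by (intro sum_mono mult_left_mono power_mono) auto

lemma prod_edges_two_values:
  assumes S: "S \<in> [V]\<^bsup>k\<^esup>"
  shows "(\<Prod>e\<in>[S]\<^bsup>2\<^esup>. if e \<in> [K]\<^bsup>2\<^esup> then q else p) =
    (q::real) ^ (card (S \<inter> K) choose 2) * p ^ ((k choose 2) - (card (S \<inter> K) choose 2))"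
proof -
  have S': "finite S" "card S = k" using S by (auto simp: nsets_def)
  have fin: "finite ([S]\<^bsup>2\<^esup>)" using S' by (simp add: finite_imp_finite_nsets)
  have c: "card ([S]\<^bsup>2\<^esup> \<inter> [K]\<^bsup>2\<^esup>) = card (S \<inter> K) choose 2" by (simp add: nsets_Int)
  have "card ([S]\<^bsup>2\<^esup> - [K]\<^bsup>2\<^esup>) = (k choose 2) - (card (S \<inter> K) choose 2)"
    using fin S' c by (simp add: card_Diff_subset_Int)
  then show ?thesis
    using c fin by (simp add: prod.If_cases Diff_eq Collect_mem_eq)
qed

text \<open>The union bound is spent only on cliques sharing an edge with \<open>K\<close>. The
  presence of any other clique is kept as one event, whose probability does not depend on the
  density on \<open>K\<close>.\<close>

lemma planted_clique_bound:
  assumes K: "K \<in> [{..<n}]\<^bsup>k\<^esup>" and k: "2 \<le> k" and p: "p \<in> {0..1}" and q: "q \<in> {0..1}"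
  shows "field_expectation (potential_edges n) (\<lambda>e. if e \<in> [K]\<^bsup>2\<^esup> then q else p)
           (\<lambda>\<omega>. of_bool (has_clique n k \<omega>)) \<le>
         field_expectation (potential_edges n) (\<lambda>_. p) (\<lambda>\<omega>. of_bool (has_clique n k \<omega>)) +
         overlap_sum n k p + q ^ (k choose 2)"
proof -
  let ?r = "\<lambda>e. if e \<in> [K]\<^bsup>2\<^esup> then q else p" and ?\<Lambda> = "potential_edges n"
  let ?N = "[{..<n}]\<^bsup>k\<^esup>"
  let ?A = "{S \<in> ?N. 2 \<le> card (S \<inter> K)}" and ?B = "{S \<in> ?N. card (S \<inter> K) < 2}"
  let ?h = "\<lambda>\<omega>. of_bool (\<exists>S\<in>?B. \<forall>e\<in>[S]\<^bsup>2\<^esup>. \<omega> e) :: real"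
  let ?g = "\<lambda>\<omega>. \<Sum>S\<in>?A. of_bool (\<forall>e\<in>[S]\<^bsup>2\<^esup>. \<omega> e) :: real"
  have finN: "finite ?N" by (simp add: finite_imp_finite_nsets)
  have le: "of_bool (has_clique n k \<omega>) \<le> ?h \<omega> + ?g \<omega>" for \<omega>
  proof (cases "\<exists>S\<in>?A. \<forall>e\<in>[S]\<^bsup>2\<^esup>. \<omega> e")
    case True
    then obtain S where S: "S \<in> ?A" "\<forall>e\<in>[S]\<^bsup>2\<^esup>. \<omega> e" by blast
    have "1 = (of_bool (\<forall>e\<in>[S]\<^bsup>2\<^esup>. \<omega> e) :: real)" using S by simp
    also have "\<dots> \<le> ?g \<omega>"
      using S(1) finN by (intro member_le_sum) auto
    finally have "1 \<le> ?g \<omega>" .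
    then show ?thesis by (simp add: of_bool_def split: if_splits)
  next
    case False
    then have "has_clique n k \<omega> \<Longrightarrow> \<exists>S\<in>?B. \<forall>e\<in>[S]\<^bsup>2\<^esup>. \<omega> e"
      unfolding has_clique_iff by (auto simp: not_less) (meson not_less)
    moreover have "0 \<le> ?g \<omega>" by (intro sum_nonneg) auto
    ultimately show ?thesis by (simp add: of_bool_def)
  qed
  \<comment> \<open>A set in \<open>?B\<close> meets \<open>K\<close> in fewer than two vertices, so
    its edges avoid those of \<open>K\<close> and the event is local off \<open>K\<close>.\<close>
  have h: "field_expectation ?\<Lambda> ?r ?h = field_expectation ?\<Lambda> (\<lambda>_. p) ?h"
  proof (rule field_expectation_local)
    fix \<omega> :: "nat set \<Rightarrow> bool"
    have "e \<notin> [K]\<^bsup>2\<^esup>" if "S \<in> ?B" "e \<in> [S]\<^bsup>2\<^esup>" for S e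
    proof
      assume "e \<in> [K]\<^bsup>2\<^esup>"
      with that have "e \<in> [S \<inter> K]\<^bsup>2\<^esup>" by (simp flip: nsets_Int)
      moreover have "finite (S \<inter> K)" using that by (auto simp: nsets_def)
      ultimately show False using that nsets_eq_empty[of "S \<inter> K" 2] by auto
    qed
    then show "?h (\<lambda>e. e \<notin> [K]\<^bsup>2\<^esup> \<and> \<omega> e) = ?h \<omega>"
      by (auto intro!: arg_cong[where f = of_bool] bex_cong ball_cong)
  qed auto
  have r: "\<And>e. ?r e \<in> {0..1}" using p q by auto
  have "field_expectation ?\<Lambda> ?r (\<lambda>\<omega>. of_bool (has_clique n k \<omega>)) \<le>
      field_expectation ?\<Lambda> ?r (\<lambda>\<omega>. ?h \<omega> + ?g \<omega>)"
    by (intro field_expectation_mono le) auto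
  also have "\<dots> = field_expectation ?\<Lambda> (\<lambda>_. p) ?h +
      (\<Sum>S\<in>?A. field_expectation ?\<Lambda> ?r (\<lambda>\<omega>. of_bool (\<forall>e\<in>[S]\<^bsup>2\<^esup>. \<omega> e)))"
    unfolding h[symmetric] by (simp add: Bochner_Integration.integral_add Bochner_Integration.integral_sum)
  also have "(\<Sum>S\<in>?A. field_expectation ?\<Lambda> ?r (\<lambda>\<omega>. of_bool (\<forall>e\<in>[S]\<^bsup>2\<^esup>. \<omega> e)))
      = (\<Sum>S\<in>?A. q ^ (card (S \<inter> K) choose 2) * p ^ ((k choose 2) - (card (S \<inter> K) choose 2)))"
  proof (rule sum.cong[OF refl])
    fix S assume S: "S \<in> ?A"
    then show "field_expectation ?\<Lambda> ?r (\<lambda>\<omega>. of_bool (\<forall>e\<in>[S]\<^bsup>2\<^esup>. \<omega> e)) =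
      q ^ (card (S \<inter> K) choose 2) * p ^ ((k choose 2) - (card (S \<inter> K) choose 2))"
      using field_expectation_all[of ?\<Lambda> "[S]\<^bsup>2\<^esup>" ?r, OF _ nsets_subset_potential_edges[of S n k] r]
        prod_edges_two_values[of S "{..<n}" k K q p]
      by simp
  qed
  also have "\<dots> \<le> (\<Sum>l\<in>{2..k}. real ((k choose l) * ((n - k) choose (k - l))) *
      (q ^ (l choose 2) * p ^ ((k choose 2) - (l choose 2))))"
    using p q by (intro sum_overlap_le[OF K]) auto
  \<comment> \<open>The term \<open>l = k\<close> is \<open>K\<close> itself and produces the power
    of \<open>q\<close>; in all others the factor coming from \<open>q\<close> is bounded by
    1.\<close>
  also have "{2..k} = insert k {2..<k}" using k by auto
  also have "(\<Sum>l\<in>insert k {2..<k}. real ((k choose l) * ((n - k) choose (k - l))) *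
      (q ^ (l choose 2) * p ^ ((k choose 2) - (l choose 2)))) =
      (\<Sum>l\<in>{2..<k}. real ((k choose l) * ((n - k) choose (k - l))) *
      (q ^ (l choose 2) * p ^ ((k choose 2) - (l choose 2)))) + q ^ (k choose 2)"
    by simp
  also have "(\<Sum>l\<in>{2..<k}. real ((k choose l) * ((n - k) choose (k - l))) *
      (q ^ (l choose 2) * p ^ ((k choose 2) - (l choose 2)))) \<le> overlap_sum n k p"
    unfolding overlap_sum_def using p q
    by (intro sum_mono mult_left_mono mult_left_le_one_le) (auto intro: power_le_one)
  also have "field_expectation ?\<Lambda> (\<lambda>_. p) ?h \<le>
      field_expectation ?\<Lambda> (\<lambda>_. p) (\<lambda>\<omega>. of_bool (has_clique n k \<omega>))"
    unfolding has_clique_iff by (intro field_expectation_mono) auto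
  finally show ?thesis by simp
qed

text \<open>Chebyshev for the number \<open>X\<close> of \<open>k\<close>-cliques at density
  \<open>p\<close>. Divided by the squared mean, each overlap term decreases in the density, so it
  may be evaluated at \<open>x\<close>, where the mean is \<open>M\<close>. The summand 1 is the
  diagonal term \<open>l = k\<close>.\<close>

lemma no_clique_second_moment:
  assumes k: "2 \<le> k" "k \<le> n" and x: "0 < x" "x \<le> p" "p \<le> 1"
    and M: "real (n choose k) * x ^ (k choose 2) = M"
  shows "1 - field_expectation (potential_edges n) (\<lambda>_. p) (\<lambda>\<omega>. of_bool (has_clique n k \<omega>)) \<le>
         (overlap_sum n k x + 1) / M"
proof -
  let ?N = "[{..<n}]\<^bsup>k\<^esup>"
  define E where "E = field_expectation (potential_edges n) (\<lambda>_. p)"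
  define Q where "Q = k choose 2"
  define I :: "nat set \<Rightarrow> nat set config \<Rightarrow> real" where "I S \<omega> = of_bool (\<forall>e\<in>[S]\<^bsup>2\<^esup>. \<omega> e)" for S \<omega>
  define X where "X \<omega> = (\<Sum>S\<in>?N. I S \<omega>)" for \<omega>
  define C where "C = real (n choose k)"
  define \<mu> where "\<mu> = C * p ^ Q"
  define w where "w l = real ((k choose l) * ((n - k) choose (k - l)))" for l
  have p: "0 < p" using x by auto
  have C: "0 < C" using k by (simp add: C_def)
  have \<mu>: "0 < \<mu>" using p C by (simp add: \<mu>_def)
  have cN: "real (card ?N) = C" by (simp add: C_def)
  have EI: "E (\<lambda>\<omega>. I S \<omega> * I T \<omega>) = p ^ (2 * Q - (card (S \<inter> T) choose 2))"
    if "S \<in> ?N" "T \<in> ?N" for S T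
  proof -
    have ST: "finite S" "card S = k" "finite T" "card T = k" using that by (auto simp: nsets_def)
    have "E (\<lambda>\<omega>. I S \<omega> * I T \<omega>) = E (\<lambda>\<omega>. of_bool (\<forall>e\<in>[S]\<^bsup>2\<^esup> \<union> [T]\<^bsup>2\<^esup>. \<omega> e))"
      unfolding I_def by (intro arg_cong[where f = E] ext) (simp add: ball_Un)
    also have "\<dots> = p ^ card ([S]\<^bsup>2\<^esup> \<union> [T]\<^bsup>2\<^esup>)"
      unfolding E_def using that x p nsets_subset_potential_edges
      by (subst field_expectation_all) auto
    also have "card ([S]\<^bsup>2\<^esup> \<union> [T]\<^bsup>2\<^esup>) = 2 * Q - (card (S \<inter> T) choose 2)"
      using card_Un_Int[of "[S]\<^bsup>2\<^esup>" "[T]\<^bsup>2\<^esup>"] ST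
      by (simp add: finite_imp_finite_nsets nsets_Int Q_def)
    finally show ?thesis .
  qed
  have EX: "E X = \<mu>"
  proof -
    have "E X = (\<Sum>S\<in>?N. E (I S))"
      unfolding X_def[abs_def] E_def by (simp add: Bochner_Integration.integral_sum)
    also have "\<dots> = (\<Sum>S\<in>?N. p ^ Q)"
    proof (rule sum.cong[OF refl])
      fix S assume S: "S \<in> ?N"
      then have "card ([S]\<^bsup>2\<^esup>) = Q" by (auto simp: nsets_def Q_def card_nsets[unfolded nsets_def])
      then show "E (I S) = p ^ Q"
        unfolding E_def I_def[abs_def] using S x p nsets_subset_potential_edges
        by (subst field_expectation_all) auto
    qed
    finally show ?thesis using cN by (simp add: \<mu>_def)
  qed
  have EXX: "E (\<lambda>\<omega>. X \<omega> * X \<omega>) \<le> \<mu> ^ 2 + C * (\<Sum>l\<in>{2..k}. w l * p ^ (2 * Q - (l choose 2)))"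
  proof -
    have "E (\<lambda>\<omega>. X \<omega> * X \<omega>) = (\<Sum>T\<in>?N. \<Sum>S\<in>?N. E (\<lambda>\<omega>. I S \<omega> * I T \<omega>))"
      unfolding X_def[abs_def] E_def sum_product
      by (subst sum.swap) (simp add: Bochner_Integration.integral_sum)
    also have "\<dots> = (\<Sum>T\<in>?N. \<Sum>S\<in>?N. p ^ (2 * Q - (card (S \<inter> T) choose 2)))"
      by (intro sum.cong refl EI)
    also have "\<dots> \<le> (\<Sum>T\<in>?N. C * p ^ (2 * Q) + (\<Sum>l\<in>{2..k}. w l * p ^ (2 * Q - (l choose 2))))"
    proof (rule sum_mono)
      fix T assume T: "T \<in> ?N"
      \<comment> \<open>Every pair is charged \<open>p ^ (2 * Q)\<close>, which sums to the squared
        mean. For overlap below 2 this is exact, as the binomial coefficient vanishes.\<close>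
      have "(\<Sum>S\<in>?N. p ^ (2 * Q - (card (S \<inter> T) choose 2))) \<le>
        (\<Sum>S\<in>?N. p ^ (2 * Q) + (if 2 \<le> card (S \<inter> T) then p ^ (2 * Q - (card (S \<inter> T) choose 2)) else 0))"
        using p by (intro sum_mono) (auto simp: not_le binomial_eq_0)
      also have "\<dots> = C * p ^ (2 * Q) +
          (\<Sum>S\<in>{S\<in>?N. 2 \<le> card (S \<inter> T)}. p ^ (2 * Q - (card (S \<inter> T) choose 2)))"
        using cN by (simp add: sum.distrib finite_imp_finite_nsets sum.inter_filter)
      also have "\<dots> \<le> C * p ^ (2 * Q) + (\<Sum>l\<in>{2..k}. w l * p ^ (2 * Q - (l choose 2)))"
        unfolding w_def using p by (intro add_left_mono sum_overlap_le[OF T]) auto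
      finally show "(\<Sum>S\<in>?N. p ^ (2 * Q - (card (S \<inter> T) choose 2))) \<le>
         C * p ^ (2 * Q) + (\<Sum>l\<in>{2..k}. w l * p ^ (2 * Q - (l choose 2)))" .
    qed
    also have "\<dots> = \<mu> ^ 2 + C * (\<Sum>l\<in>{2..k}. w l * p ^ (2 * Q - (l choose 2)))"
      using cN by (simp add: \<mu>_def power_mult power2_eq_square algebra_simps power_add[symmetric] mult_2)
    finally show ?thesis .
  qed
  have "\<mu>\<^sup>2 * (1 - E (\<lambda>\<omega>. of_bool (has_clique n k \<omega>))) = E (\<lambda>\<omega>. \<mu>\<^sup>2 * (1 - of_bool (has_clique n k \<omega>)))"
    unfolding E_def by (simp add: Bochner_Integration.integral_diff)
  \<comment> \<open>Without a clique \<open>X\<close> is 0, so its squared deviation from the mean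
    is exactly \<open>\<mu>\<^sup>2\<close>.\<close>
  also have "\<dots> \<le> E (\<lambda>\<omega>. X \<omega> * X \<omega> - 2 * \<mu> * X \<omega> + \<mu>\<^sup>2)"
    unfolding E_def
  proof (rule field_expectation_mono)
    fix \<omega>
    show "\<mu>\<^sup>2 * (1 - of_bool (has_clique n k \<omega>)) \<le> X \<omega> * X \<omega> - 2 * \<mu> * X \<omega> + \<mu>\<^sup>2"
    proof (cases "has_clique n k \<omega>")
      case True
      have "0 \<le> (X \<omega> - \<mu>)\<^sup>2" by simp
      also have "\<dots> = X \<omega> * X \<omega> - 2 * \<mu> * X \<omega> + \<mu>\<^sup>2" by (simp add: power2_eq_square algebra_simps)
      finally show ?thesis using True by simp
    next
      case False
      then have "X \<omega> = 0" unfolding X_def I_def has_clique_iff by (intro sum.neutral) auto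
      then show ?thesis by simp
    qed
  qed auto
  also have "\<dots> = E (\<lambda>\<omega>. X \<omega> * X \<omega>) - 2 * \<mu> * E X + \<mu>\<^sup>2"
    unfolding E_def by (simp add: Bochner_Integration.integral_diff Bochner_Integration.integral_add)
  also have "\<dots> \<le> C * (\<Sum>l\<in>{2..k}. w l * p ^ (2 * Q - (l choose 2)))"
    using EXX EX by (simp add: power2_eq_square)
  also have "\<dots> \<le> \<mu>\<^sup>2 * ((\<Sum>l\<in>{2..k}. w l * x ^ (Q - (l choose 2))) / M)"
  proof -
    have M0: "0 < M" using C x by (simp add: M[symmetric] C_def)
    have "C * p ^ (2 * Q - (l choose 2)) \<le> \<mu>\<^sup>2 * (x ^ (Q - (l choose 2)) / M)" if "l \<in> {2..k}" for l
    proof -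
      define c where "c = l choose 2"
      have c: "c \<le> Q" unfolding c_def Q_def using that by (intro binomial_mono_left) auto
      \<comment> \<open>The comparison of the inverse powers of \<open>p\<close> and
        \<open>x\<close> is cleared of negative exponents: it amounts to
        \<open>x ^ c \<le> p ^ c\<close>.\<close>
      have "p ^ (2 * Q - c) * x ^ c \<le> p ^ (2 * Q - c) * p ^ c"
        using x by (intro mult_left_mono power_mono) auto
      also have "\<dots> = p ^ (2 * Q)" using c by (simp add: power_add[symmetric])
      finally have *: "p ^ (2 * Q - c) * x ^ c \<le> p ^ (2 * Q)" .
      have "M = C * (x ^ (Q - c) * x ^ c)"
        using c M by (simp add: C_def Q_def power_add[symmetric])
      then have "C * p ^ (2 * Q - c) * M = C\<^sup>2 * x ^ (Q - c) * (p ^ (2 * Q - c) * x ^ c)"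
        by (simp add: power2_eq_square)
      also have "\<dots> \<le> C\<^sup>2 * x ^ (Q - c) * p ^ (2 * Q)"
        using * x by (intro mult_left_mono) auto
      also have "\<dots> = \<mu>\<^sup>2 * x ^ (Q - c)"
        by (simp add: \<mu>_def power_mult_distrib power_mult[symmetric] mult.commute)
      finally show ?thesis using M0 by (simp add: c_def field_simps)
    qed
    then have "(\<Sum>l\<in>{2..k}. w l * (C * p ^ (2 * Q - (l choose 2)))) \<le>
       (\<Sum>l\<in>{2..k}. w l * (\<mu>\<^sup>2 * (x ^ (Q - (l choose 2)) / M)))"
      by (intro sum_mono mult_left_mono) (auto simp: w_def)
    then show ?thesis by (simp add: sum_distrib_left sum_divide_distrib mult_ac)
  qed
  also have "(\<Sum>l\<in>{2..k}. w l * x ^ (Q - (l choose 2))) = overlap_sum n k x + 1"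
  proof -
    have "{2..k} = insert k {2..<k}" using k by auto
    then show ?thesis by (simp add: overlap_sum_def w_def Q_def)
  qed
  finally have "1 - E (\<lambda>\<omega>. of_bool (has_clique n k \<omega>)) \<le> (overlap_sum n k x + 1) / M"
    by (rule mult_left_le_imp_le) (use \<mu> in simp)
  then show ?thesis by (simp add: E_def)
qed

section \<open>Estimates at the critical density\<close>

text \<open>
  The parametrisation \<open>s = sqrt x\<close> makes all exponents natural numbers: \<open>s ^ (k - 1)\<close> has the
  order \<open>n powr (-1)\<close> up to factors that are powers of \<open>k\<close>.
\<close>

lemma two_times_choose_two: "2 * (k choose 2) = k * (k - 1)"
proof -
  have "even (k * (k - 1))" by (cases k) auto
  then show ?thesis by (simp add: choose_two)
qed

text \<open>The \<open>k\<close>-th power of \<open>s ^ (k - 1)\<close> is \<open>M / C\<close>,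
  where \<open>C\<close> is the number of \<open>k\<close>-sets. Both bounds are \<open>k\<close>-th
  roots of the standard estimates of \<open>C\<close> between \<open>(n / k) ^ k\<close> and
  \<open>n ^ k\<close>.\<close>

lemma sqrt_critical_density_bounds:
  assumes k: "2 \<le> k" "k \<le> n" and M: "1 \<le> M" and s: "0 < s"
    and eq: "real (n choose k) * (s\<^sup>2) ^ (k choose 2) = M"
  shows "s ^ (k - 1) \<le> M * real k / real n" and "1 / real n \<le> s ^ (k - 1)"
proof -
  define C where "C = real (n choose k)"
  have C: "0 < C" using k by (simp add: C_def)
  have "(s ^ (k - 1)) ^ k = s ^ (2 * (k choose 2))"
    by (simp only: two_times_choose_two power_mult[symmetric] mult.commute)
  also have "\<dots> = M / C" using eq C by (simp add: C_def power_mult field_simps)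
  finally have yk: "(s ^ (k - 1)) ^ k = M / C" .
  have "(real n / real k) ^ k \<le> C" unfolding C_def using k(2) by (rule binomial_ge_n_over_k_pow_k)
  moreover have "0 < (real n / real k) ^ k" using k by simp
  ultimately have "M / C \<le> M / (real n / real k) ^ k"
    using M by (intro divide_left_mono) auto
  also have "\<dots> = M * (real k / real n) ^ k" by (simp add: power_divide)
  \<comment> \<open>\<open>M\<close> is inflated to \<open>M ^ k\<close> so that the right-hand side
    becomes a perfect \<open>k\<close>-th power.\<close>
  also have "\<dots> \<le> M ^ k * (real k / real n) ^ k"
    using M k by (intro mult_right_mono self_le_power) auto
  finally have "(s ^ (k - 1)) ^ k \<le> (M * real k / real n) ^ k"
    unfolding yk by (simp add: power_mult_distrib[symmetric])
  then show "s ^ (k - 1) \<le> M * real k / real n"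
    by (subst (asm) power_mono_iff) (use k M s in auto)
  have "C \<le> real n ^ k" unfolding C_def using binomial_le_pow[OF k(2)] by (metis of_nat_le_iff of_nat_power)
  then have "(1 / real n) ^ k \<le> M / C"
    using M C k by (simp add: power_one_over frac_le)
  then have "(1 / real n) ^ k \<le> (s ^ (k - 1)) ^ k" unfolding yk .
  then show "1 / real n \<le> s ^ (k - 1)"
    by (subst (asm) power_mono_iff) (use k s in auto)
qed

text \<open>Each of the fewer than \<open>k\<close> summands is at most \<open>sqrt D\<close>. If
  \<open>S\<close> misses few vertices of \<open>K\<close>, crude counting beats the many new edges.
  If the overlap is small, the summand is compared with the total mean \<open>M\<close>, the loss
  being the inverse probability of the shared edges.\<close>

lemma overlap_sum_bound:
  assumes k: "2 \<le> k" "k \<le> n" and M: "1 \<le> M" and x: "0 < x"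
    and eq: "real (n choose k) * x ^ (k choose 2) = M"
    and D: "M ^ 3 * real k ^ 6 / real n \<le> 1"
  shows "overlap_sum n k x \<le> real k * sqrt (M ^ 3 * real k ^ 6 / real n)"
proof -
  define D where "D = M ^ 3 * real k ^ 6 / real n"
  define s where "s = sqrt x"
  define y where "y = s ^ (k - 1)"
  define Q where "Q = k choose 2"
  define C where "C = real (n choose k)"
  have n: "0 < real n" "0 < real k" "1 \<le> real k" using k by auto
  have s: "0 < s" "s\<^sup>2 = x" using x by (auto simp: s_def)
  have C: "0 < C" using k by (simp add: C_def)
  have y: "y \<le> M * real k / real n" "1 / real n \<le> y"
    unfolding y_def using sqrt_critical_density_bounds[OF k M s(1)] eq s(2) by auto
  \<comment> \<open>Leads to \<open>y \<le> 1\<close>, hence \<open>s \<le> 1\<close>, so that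
    powers of \<open>s\<close> decrease in the exponent.\<close>
  have "M * real k \<le> M ^ 3 * real k ^ 6"
    using M n by (intro mult_mono self_le_power) auto
  then have "M * real k / real n \<le> D" unfolding D_def using n by (intro divide_right_mono) auto
  with y D have "y \<le> 1" by (simp add: D_def)
  then have s1: "s \<le> 1" unfolding y_def using k s by (subst (asm) power_le_one_iff) auto
  have term_bound: "real ((k choose l) * ((n - k) choose (k - l))) * x ^ (Q - (l choose 2)) \<le> sqrt D"
    if l: "l \<in> {2..<k}" for l
  proof -
    define c where "c = l choose 2"
    define N where "N = real ((k choose l) * ((n - k) choose (k - l)))"
    obtain j where j: "k = l + j" "0 < j" using l by (auto dest: less_imp_add_positive)
    have c: "c \<le> Q" unfolding c_def Q_def using l by (intro binomial_mono_left) auto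
    \<comment> \<open>Squaring avoids half-integral powers of \<open>n\<close>; \<open>j\<close> is
      the number of vertices of \<open>S\<close> outside the fixed clique.\<close>
    have "(N * x ^ (Q - c))\<^sup>2 \<le> D"
    proof (cases "j \<le> l")
      case True
      have exponent: "2 * Q - 2 * c = j * (2 * l + j - 1)"
      proof -
        have "2 * Q = j * (2 * l + j - 1) + 2 * c"
          unfolding Q_def c_def two_times_choose_two j(1)
          using j(2) l by (cases j; cases l) (auto simp: algebra_simps)
        then show ?thesis by simp
      qed
      have "3 * (k - 1) * j \<le> 2 * (j * (2 * l + j - 1))"
      proof -
        \<comment> \<open>Here \<open>j \<le> l\<close> enters: after substituting
          \<open>k = l + j\<close>, the sides differ by \<open>l - j + 1\<close>.\<close>
        have "3 * (k - 1) \<le> 2 * (2 * l + j - 1)" using True j l by auto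
        then have "j * (3 * (k - 1)) \<le> j * (2 * (2 * l + j - 1))" by (rule mult_le_mono2)
        then show ?thesis by (simp only: ac_simps)
      qed
      also have "\<dots> = 4 * (Q - c)" unfolding exponent[symmetric] by simp
      finally have ex: "3 * (k - 1) * j \<le> 4 * (Q - c)" .
      have "(x ^ (Q - c))\<^sup>2 = s ^ (4 * (Q - c))"
        unfolding s(2)[symmetric] power_mult[symmetric] by (simp add: mult_ac)
      also have "\<dots> \<le> s ^ (3 * (k - 1) * j)" using ex s s1 by (intro power_decreasing) auto
      also have "\<dots> = (y ^ 3) ^ j" by (simp add: y_def power_mult[symmetric] mult_ac)
      also have "\<dots> \<le> ((M * real k / real n) ^ 3) ^ j"
        using y s by (intro power_mono) (auto simp: y_def)
      finally have xs: "(x ^ (Q - c))\<^sup>2 \<le> ((M * real k / real n) ^ 3) ^ j" .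
      have "k choose l \<le> k ^ j"
        using binomial_le_pow[of j k] binomial_symmetric[of l k] j by simp
      moreover have "(n - k) choose (k - l) \<le> n ^ j"
      proof -
        have "(n - k) choose j \<le> n choose j" by (intro binomial_mono_left) auto
        also have "\<dots> \<le> n ^ j" using j k by (intro binomial_le_pow) auto
        finally show ?thesis using j by simp
      qed
      ultimately have "(k choose l) * ((n - k) choose (k - l)) \<le> (k * n) ^ j"
        unfolding power_mult_distrib by (rule mult_le_mono)
      then have "N \<le> (real k * real n) ^ j" unfolding N_def by (metis of_nat_le_iff of_nat_mult of_nat_power)
      then have "N\<^sup>2 \<le> ((real k * real n) ^ j)\<^sup>2" by (intro power_mono) (auto simp: N_def)
      with xs have "N\<^sup>2 * (x ^ (Q - c))\<^sup>2 \<le> ((real k * real n) ^ j)\<^sup>2 * ((M * real k / real n) ^ 3) ^ j"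
        by (intro mult_mono) auto
      also have "\<dots> = ((real k * real n)\<^sup>2 * (M * real k / real n) ^ 3) ^ j"
        by (simp add: power_mult_distrib power_mult[symmetric] mult.commute)
      \<comment> \<open>Counting gives two powers of \<open>n\<close> and the edges take away three,
        leaving a factor \<open>1 / n\<close> for each of the \<open>j\<close> new vertices.\<close>
      also have "(real k * real n)\<^sup>2 * (M * real k / real n) ^ 3 = M ^ 3 * real k ^ 5 / real n"
        using n by (simp add: field_simps eval_nat_numeral)
      also have "\<dots> ^ j \<le> D ^ j"
        unfolding D_def using n M
        by (intro power_mono divide_right_mono mult_left_mono power_increasing) auto
      also have "D ^ j \<le> D" using D M j n power_decreasing[of 1 j D] by (simp add: D_def)
      finally show ?thesis by (simp add: power_mult_distrib)
    next
      case False
      \<comment> \<open>The \<open>c\<close> shared edges have probability at least \<open>n\<close>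
        to the power \<open>- l / 2\<close>, because \<open>l < j\<close> makes
        \<open>2 * (l - 1)\<close> at most \<open>k - 1\<close>.\<close>
      have "s ^ (l * (k - 1)) \<le> s ^ (2 * (l * (l - 1)))"
      proof (rule power_decreasing)
        have "2 * (l - 1) \<le> k - 1" using False j by auto
        then have "l * (2 * (l - 1)) \<le> l * (k - 1)" by (rule mult_le_mono2)
        then show "2 * (l * (l - 1)) \<le> l * (k - 1)" by (simp only: ac_simps)
      qed (use s s1 in auto)
      also have "\<dots> = (x ^ c)\<^sup>2"
        unfolding c_def two_times_choose_two[symmetric] s(2)[symmetric] power_mult[symmetric]
        by (simp add: mult_ac)
      finally have "y ^ l \<le> (x ^ c)\<^sup>2" by (simp add: y_def power_mult[symmetric] mult.commute)
      moreover have "(1 / real n) ^ l \<le> y ^ l" using y n by (intro power_mono) auto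
      ultimately have xc: "(1 / real n) ^ l \<le> (x ^ c)\<^sup>2" by simp
      \<comment> \<open>Double counting of pairs of a \<open>k\<close>-set and an
        \<open>l\<close>-subset trades the choice of the remaining vertices for \<open>C\<close>,
        gaining a factor of order \<open>n ^ l\<close>.\<close>
      have "N * (real n / real l) ^ l \<le> real (k ^ (2 * l)) * C"
      proof -
        have "(n - k) choose (k - l) \<le> (n - l) choose (k - l)"
          using l by (intro binomial_mono_left) auto
        then have "N \<le> real (k choose l) * real ((n - l) choose (k - l))"
          unfolding N_def of_nat_mult by (intro mult_left_mono) auto
        moreover have "(real n / real l) ^ l \<le> real (n choose l)"
          using l k by (intro binomial_ge_n_over_k_pow_k) auto
        ultimately have "N * (real n / real l) ^ l \<le>
            real (k choose l) * real ((n - l) choose (k - l)) * real (n choose l)"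
          by (intro mult_mono) auto
        also have "\<dots> = real (k choose l) * real ((n choose l) * ((n - l) choose (k - l)))"
          by simp
        also have "(n choose l) * ((n - l) choose (k - l)) = (n choose k) * (k choose l)"
          using l k choose_mult[of l k n] by simp
        also have "real (k choose l) * real ((n choose k) * (k choose l)) = (real (k choose l))\<^sup>2 * C"
          by (simp add: C_def power2_eq_square)
        also have "\<dots> \<le> (real (k ^ l))\<^sup>2 * C"
          using C l binomial_le_pow[of l k] by (intro mult_right_mono power_mono) (auto simp del: of_nat_power)
        also have "\<dots> = real (k ^ (2 * l)) * C" by (simp add: power_mult[symmetric] mult.commute)
        finally show ?thesis .
      qed
      then have "N * (real n / real l) ^ l * real (l ^ l) \<le> real (k ^ (2 * l)) * C * real (k ^ l)"
        by (rule mult_mono) (use l C in \<open>auto intro: power_mono\<close>)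
      moreover have "(real n / real l) ^ l * real (l ^ l) = real n ^ l"
        using l by (simp add: power_divide)
      moreover have "real (k ^ (2 * l)) * C * real (k ^ l) = (real k ^ 3) ^ l * C"
        by (simp add: power_mult[symmetric] power_add[symmetric] algebra_simps)
      ultimately have NC: "N * real n ^ l \<le> (real k ^ 3) ^ l * C"
        by (simp only: mult.assoc)
      have MC: "x ^ (Q - c) * x ^ c * C = M"
        using c eq by (simp add: power_add[symmetric] C_def Q_def mult.commute)
      \<comment> \<open>Inserting \<open>x ^ c\<close> completes the edge probability to
        \<open>x ^ Q\<close>, which together with \<open>C\<close> gives \<open>M\<close>.\<close>
      have "(N * x ^ (Q - c))\<^sup>2 * ((1 / real n) ^ l * (real n ^ l)\<^sup>2) \<le>
            (N * x ^ (Q - c))\<^sup>2 * ((x ^ c)\<^sup>2 * (real n ^ l)\<^sup>2)"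
        using xc by (intro mult_left_mono mult_right_mono) auto
      also have "\<dots> = (N * real n ^ l * (x ^ (Q - c) * x ^ c))\<^sup>2"
        by (simp add: power_mult_distrib mult_ac)
      also have "\<dots> \<le> ((real k ^ 3) ^ l * C * (x ^ (Q - c) * x ^ c))\<^sup>2"
        using NC x n by (intro power_mono mult_right_mono) (auto simp: N_def)
      also have "(real k ^ 3) ^ l * C * (x ^ (Q - c) * x ^ c) = (real k ^ 3) ^ l * M"
        using MC by (simp add: mult_ac)
      also have "(1 / real n) ^ l * (real n ^ l)\<^sup>2 = real n ^ l"
        using n by (simp add: power_one_over power2_eq_square)
      also have "((real k ^ 3) ^ l * M)\<^sup>2 = M\<^sup>2 * (real k ^ 6) ^ l"
        by (simp add: power_mult_distrib power_mult[symmetric] mult_ac)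
      finally have "(N * x ^ (Q - c))\<^sup>2 * real n ^ l \<le> M\<^sup>2 * (real k ^ 6) ^ l" .
      then have "(N * x ^ (Q - c))\<^sup>2 \<le> M\<^sup>2 * (real k ^ 6 / real n) ^ l"
        using n by (simp add: power_divide field_simps)
      also have "\<dots> \<le> M ^ 3 * (real k ^ 6 / real n)"
      proof (intro mult_mono)
        have "real k ^ 6 / real n \<le> D"
          unfolding D_def using M n by (intro divide_right_mono) (auto intro: mult_le_cancel_right1[THEN iffD2])
        then have "real k ^ 6 / real n \<le> 1" using D by (simp add: D_def)
        then show "(real k ^ 6 / real n) ^ l \<le> real k ^ 6 / real n"
          using l power_decreasing[of 1 l "real k ^ 6 / real n"] by simp
      qed (use M in \<open>auto intro: power_increasing\<close>)
      finally show ?thesis by (simp add: D_def)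
    qed
    then show ?thesis unfolding N_def c_def by (rule real_le_rsqrt)
  qed
  have "overlap_sum n k x \<le> (\<Sum>l\<in>{2..<k}. sqrt D)"
    unfolding overlap_sum_def using term_bound by (intro sum_mono) (simp add: Q_def)
  also have "\<dots> \<le> real k * sqrt D"
    using M n by (simp add: D_def mult_right_mono)
  finally show ?thesis by (simp add: D_def)
qed

text \<open>Bernoulli's inequality applied to \<open>x ^ (k - 1) \<le> 1/4\<close> shows that \<open>(k - 1) (1 - x) \<ge> 3/4\<close>.\<close>
lemma noisy_clique_survival_bound:
  assumes k: "2 \<le> k" "k \<le> n" and M: "1 \<le> M" and x: "0 < x"
    and eq: "real (n choose k) * x ^ (k choose 2) = M"
    and small: "M * real k / real n \<le> 1 / 2" and \<epsilon>: "\<epsilon> \<in> {0..1}" and p: "0 \<le> p" "p \<le> x"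
  shows "((1 - \<epsilon>) + \<epsilon> * p) ^ (k choose 2) \<le> exp (- (3 / 8 * \<epsilon> * real k))"
proof -
  have "sqrt x ^ (k - 1) \<le> 1 / 2"
    using order_trans[OF sqrt_critical_density_bounds(1)[OF k M, of "sqrt x"] small] x eq by simp
  then have "(sqrt x ^ (k - 1))\<^sup>2 \<le> (1 / 2)\<^sup>2" using x by (intro power_mono) auto
  moreover have "(sqrt x ^ (k - 1))\<^sup>2 = x ^ (k - 1)"
    using x by (simp add: power_mult[symmetric] mult.commute[of _ 2]) (simp add: power_mult)
  ultimately have "x ^ (k - 1) \<le> 1 / 4" by (simp add: power2_eq_square)
  moreover have "1 + real (k - 1) * (x - 1) \<le> x ^ (k - 1)"
    using Bernoulli_inequality[of "x - 1" "k - 1"] x by simp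
  moreover have "real (k - 1) * (1 - x) = - (real (k - 1) * (x - 1))"
    by (metis minus_diff_eq mult_minus_right)
  ultimately have "3 / 4 \<le> real (k - 1) * (1 - x)" by linarith
  \<comment> \<open>The factor \<open>k / 2\<close> turns \<open>k - 1\<close> into the number of
    edges of the clique.\<close>
  then have "real k / 2 * (3 / 4) \<le> real k / 2 * (real (k - 1) * (1 - x))"
    by (rule mult_left_mono) simp
  also have "\<dots> = real (2 * (k choose 2)) / 2 * (1 - x)" unfolding two_times_choose_two by simp
  also have "\<dots> \<le> real (k choose 2) * (1 - p)" using p by (simp add: mult_left_mono)
  finally have Q: "3 / 8 * real k \<le> real (k choose 2) * (1 - p)" by simp
  have "((1 - \<epsilon>) + \<epsilon> * p) ^ (k choose 2) \<le> exp (- (\<epsilon> * (1 - p))) ^ (k choose 2)"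
  proof (rule power_mono)
    show "(1 - \<epsilon>) + \<epsilon> * p \<le> exp (- (\<epsilon> * (1 - p)))"
      using exp_ge_add_one_self[of "- (\<epsilon> * (1 - p))"] by (simp add: algebra_simps)
    show "0 \<le> (1 - \<epsilon>) + \<epsilon> * p" using \<epsilon> p by simp
  qed
  also have "\<dots> = exp (- (\<epsilon> * (real (k choose 2) * (1 - p))))"
    by (simp add: exp_of_nat_mult[symmetric] mult_ac)
  also have "\<dots> \<le> exp (- (\<epsilon> * (3 / 8 * real k)))"
    using mult_left_mono[OF Q, of \<epsilon>] \<epsilon> by simp
  finally show ?thesis by (simp add: mult_ac)
qed

text \<open>Eventually the exponent is so small that the \<open>m\<close>-th power is at most
  \<open>sqrt n\<close>.\<close>

lemma subpolynomial_power_over_n: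
  fixes k :: "nat \<Rightarrow> nat"
  assumes "\<delta> \<in> o(\<lambda>_. 1 :: real)" "\<forall>\<^sub>F n in sequentially. real (k n) = real n powr \<delta> n"
  shows "(\<lambda>n. real (k n) ^ m / real n) \<longlonglongrightarrow> 0"
proof -
  \<comment> \<open>The shift \<open>m + 1\<close> keeps \<open>c\<close> positive for
    \<open>m = 0\<close> as well.\<close>
  define c where "c = 1 / (2 * (real m + 1))"
  have c: "0 < c" "real m * c \<le> 1 / 2" by (auto simp: c_def field_simps)
  have "\<forall>\<^sub>F n in sequentially. norm (\<delta> n) \<le> c * norm (1::real)"
    using assms(1) c(1) by (rule landau_o.smallD)
  then have "\<forall>\<^sub>F n in sequentially. norm (real (k n) ^ m / real n) \<le> real n powr (-1/2)"
    using assms(2) eventually_ge_at_top[of 1]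
  proof eventually_elim
    case (elim n)
    have "real m * \<delta> n \<le> real m * c" using elim by (intro mult_left_mono) auto
    then have "real m * \<delta> n \<le> 1 / 2" using c by simp
    then have "real n powr (real m * \<delta> n) \<le> real n powr (1 / 2)"
      using elim by (intro powr_mono) auto
    moreover have "real (k n) ^ m = real n powr (real m * \<delta> n)"
      using elim by (simp add: powr_power mult.commute)
    ultimately have "real (k n) ^ m / real n \<le> real n powr (1 / 2) / real n powr 1"
      using elim by (simp add: divide_right_mono)
    also have "\<dots> = real n powr (-1/2)" by (subst powr_diff[symmetric]) simp
    finally show ?case by simp
  qed
  moreover have "(\<lambda>n. real n powr (-1/2)) \<longlonglongrightarrow> 0"
    by (intro tendsto_neg_powr filterlim_real_sequentially) auto
  ultimately show ?thesis by (rule Lim_null_comparison)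
qed

section \<open>Noise sensitivity of cliques\<close>

definition clique_prob :: "nat \<Rightarrow> nat \<Rightarrow> real \<Rightarrow> real" where
  "clique_prob n k p =
     field_expectation (potential_edges n) (\<lambda>_. p) (\<lambda>\<omega>. of_bool (has_clique n k \<omega>))"

lemma planted_noise_bound:
  fixes c \<epsilon> p :: real and k n :: nat
  defines "D \<equiv> (2 / c) ^ 3 * real k ^ 6 / real n"
  assumes k: "2 \<le> k" "k \<le> n" and p: "p \<in> {0..1}" and \<epsilon>: "\<epsilon> \<in> {0..1}"
    and c: "0 < c" "c \<le> 1" and P: "clique_prob n k p \<le> 1 - c"
    and D: "D \<le> 1 / 2" "real k * sqrt D < 1"
    and K: "K \<in> [{..<n}]\<^bsup>k\<^esup>"
  shows "field_expectation (potential_edges n) (plant ([K]\<^bsup>2\<^esup>) (\<lambda>_. p))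
      (noise_operator (potential_edges n) p \<epsilon> (\<lambda>\<omega>. of_bool (has_clique n k \<omega>))) \<le>
    clique_prob n k p + real k * sqrt D + exp (- (3 / 8 * \<epsilon> * real k))"
proof -
  \<comment> \<open>Chosen so that at densities above \<open>x\<close> the probability of no clique
    is below \<open>2 / M = c\<close>, contradicting \<open>P\<close>.\<close>
  define M where "M = 2 / c"
  define C where "C = real (n choose k)"
  define Q where "Q = k choose 2"
  \<comment> \<open>The density at which the expected number of cliques is exactly
    \<open>M\<close>.\<close>
  define x where "x = root Q (M / C)"
  have M: "1 \<le> M" using c by (simp add: M_def)
  have C: "0 < C" using k by (simp add: C_def)
  have "2 * Q > 0" unfolding Q_def two_times_choose_two using k by simp
  then have Q: "0 < Q" by simp
  have x: "0 < x" using M C Q by (simp add: x_def)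
  have eq: "real (n choose k) * x ^ (k choose 2) = M"
    using M C Q by (simp add: x_def real_root_pow_pos2 flip: Q_def C_def)
  have T: "overlap_sum n k x \<le> real k * sqrt D"
  proof -
    have "M ^ 3 * real k ^ 6 / real n = D" by (simp add: M_def D_def)
    from overlap_sum_bound[OF k M x eq, unfolded this] D(1) show ?thesis by simp
  qed
  have "p < x"
  proof (rule ccontr)
    assume "\<not> p < x"
    then have "1 - clique_prob n k p \<le> (overlap_sum n k x + 1) / M"
      unfolding clique_prob_def using p x eq k by (intro no_clique_second_moment) auto
    also have "\<dots> < (1 + 1) / M" using T D M by (intro divide_strict_right_mono) auto
    also have "\<dots> = c" using c by (simp add: M_def)
    finally show False using P by simp
  qed
  have "M * real k \<le> M ^ 3 * real k ^ 6"
    using M k by (intro mult_mono self_le_power) auto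
  then have "M * real k / real n \<le> D" unfolding D_def M_def by (intro divide_right_mono) auto
  then have small: "M * real k / real n \<le> 1 / 2" using D(1) by linarith
  define q where "q = (1 - \<epsilon>) + \<epsilon> * p"
  have q: "q \<in> {0..1}" using p \<epsilon> by (auto simp: q_def mult_left_le)
  have "field_expectation (potential_edges n) (plant ([K]\<^bsup>2\<^esup>) (\<lambda>_. p))
      (noise_operator (potential_edges n) p \<epsilon> (\<lambda>\<omega>. of_bool (has_clique n k \<omega>))) =
    field_expectation (potential_edges n) (\<lambda>e. (1 - \<epsilon>) * plant ([K]\<^bsup>2\<^esup>) (\<lambda>_. p) e + \<epsilon> * p)
      (\<lambda>\<omega>. of_bool (has_clique n k \<omega>))"
    using p \<epsilon> by (intro field_expectation_noise) (auto simp: plant_def)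
  also have "(\<lambda>e. (1 - \<epsilon>) * plant ([K]\<^bsup>2\<^esup>) (\<lambda>_. p) e + \<epsilon> * p) = (\<lambda>e. if e \<in> [K]\<^bsup>2\<^esup> then q else p)"
    by (auto simp: plant_def q_def algebra_simps)
  also have "field_expectation (potential_edges n) \<dots> (\<lambda>\<omega>. of_bool (has_clique n k \<omega>)) \<le>
      clique_prob n k p + overlap_sum n k p + q ^ (k choose 2)"
    unfolding clique_prob_def using K k(1) p q by (rule planted_clique_bound)
  also have "overlap_sum n k p \<le> real k * sqrt D"
    using overlap_sum_mono[of p x n k] p \<open>p < x\<close> T by auto
  also have "q ^ (k choose 2) \<le> exp (- (3 / 8 * \<epsilon> * real k))"
    unfolding q_def using p \<open>p < x\<close>
    by (intro noisy_clique_survival_bound[OF k M x eq small \<epsilon>]) auto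
  finally show ?thesis by simp
qed

text \<open>Forcing sets are those containing all edges of some \<open>k\<close>-set. The edge sets
  of \<open>k\<close>-sets have equal size, so none properly contains another and all are
  minimal.\<close>

lemma one_witnesses_has_clique:
  assumes k: "2 \<le> k"
  shows "one_witnesses (potential_edges n) (has_clique n k) = (\<lambda>S. [S]\<^bsup>2\<^esup>) ` [{..<n}]\<^bsup>k\<^esup>"
proof -
  let ?\<Lambda> = "potential_edges n"
  have forces: "forces_one ?\<Lambda> (has_clique n k) W \<longleftrightarrow> W \<subseteq> ?\<Lambda> \<and> (\<exists>S\<in>[{..<n}]\<^bsup>k\<^esup>. [S]\<^bsup>2\<^esup> \<subseteq> W)" for W
  proof
    assume W: "forces_one ?\<Lambda> (has_clique n k) W"
    then have sub: "W \<subseteq> ?\<Lambda>" by (simp add: forces_one_def)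
    \<comment> \<open>The test configuration is the graph with edge set exactly
      \<open>W\<close>.\<close>
    then have "(\<lambda>e. e \<in> W) \<in> configs ?\<Lambda>" by (auto simp: configs_def PiE_dflt_def)
    with W have "has_clique n k (\<lambda>e. e \<in> W)" by (simp add: forces_one_def)
    with sub show "W \<subseteq> ?\<Lambda> \<and> (\<exists>S\<in>[{..<n}]\<^bsup>k\<^esup>. [S]\<^bsup>2\<^esup> \<subseteq> W)"
      by (simp only: has_clique_iff subset_iff Ball_def)
  next
    assume W: "W \<subseteq> ?\<Lambda> \<and> (\<exists>S\<in>[{..<n}]\<^bsup>k\<^esup>. [S]\<^bsup>2\<^esup> \<subseteq> W)"
    then obtain S where "S \<in> [{..<n}]\<^bsup>k\<^esup>" "[S]\<^bsup>2\<^esup> \<subseteq> W" by blast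
    then have "has_clique n k \<omega>" if "\<forall>e\<in>W. \<omega> e" for \<omega>
      unfolding has_clique_iff using that by (intro bexI[of _ S] ballI) (simp_all add: subset_iff)
    then show "forces_one ?\<Lambda> (has_clique n k) W" using W by (simp add: forces_one_def)
  qed
  have no_proper: "\<not> [S]\<^bsup>2\<^esup> \<subset> [T]\<^bsup>2\<^esup>" if "S \<in> [{..<n}]\<^bsup>k\<^esup>" "T \<in> [{..<n}]\<^bsup>k\<^esup>" for S T
  proof
    assume "[S]\<^bsup>2\<^esup> \<subset> [T]\<^bsup>2\<^esup>"
    moreover have "finite ([T]\<^bsup>2\<^esup>)" using that by (auto simp: nsets_def)
    ultimately have "card ([S]\<^bsup>2\<^esup>) < card ([T]\<^bsup>2\<^esup>)" by (intro psubset_card_mono)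
    moreover have "card S = card T" using that by (simp add: nsets_def)
    ultimately show False by simp
  qed
  show ?thesis
  proof (intro equalityI subsetI)
    fix W assume W: "W \<in> one_witnesses ?\<Lambda> (has_clique n k)"
    then obtain S where S: "S \<in> [{..<n}]\<^bsup>k\<^esup>" "[S]\<^bsup>2\<^esup> \<subseteq> W"
      by (simp only: one_witnesses_def mem_Collect_eq forces) blast
    then have "forces_one ?\<Lambda> (has_clique n k) ([S]\<^bsup>2\<^esup>)"
      unfolding forces using nsets_subset_potential_edges by auto
    then have "\<not> [S]\<^bsup>2\<^esup> \<subset> W" using W by (auto simp only: one_witnesses_def mem_Collect_eq)
    then have "W = [S]\<^bsup>2\<^esup>" using S by (simp only: psubset_eq) blast
    then show "W \<in> (\<lambda>S. [S]\<^bsup>2\<^esup>) ` [{..<n}]\<^bsup>k\<^esup>" using S by auto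
  next
    fix W assume "W \<in> (\<lambda>S. [S]\<^bsup>2\<^esup>) ` [{..<n}]\<^bsup>k\<^esup>"
    then obtain S where S: "S \<in> [{..<n}]\<^bsup>k\<^esup>" "W = [S]\<^bsup>2\<^esup>" by auto
    have "\<not> forces_one ?\<Lambda> (has_clique n k) V" if "V \<subset> W" for V
    proof
      assume "forces_one ?\<Lambda> (has_clique n k) V"
      then obtain T where T: "T \<in> [{..<n}]\<^bsup>k\<^esup>" "[T]\<^bsup>2\<^esup> \<subseteq> V" unfolding forces by blast
      then have "[T]\<^bsup>2\<^esup> \<subset> [S]\<^bsup>2\<^esup>" using that unfolding S(2) by (meson subset_psubset_trans)
      then show False using no_proper T(1) S(1) by simp
    qed
    moreover have "forces_one ?\<Lambda> (has_clique n k) W"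
      unfolding forces S(2) using nsets_subset_potential_edges[OF S(1)] S(1) by auto
    ultimately show "W \<in> one_witnesses ?\<Lambda> (has_clique n k)"
      by (simp add: one_witnesses_def)
  qed
qed

text \<open>Harris makes both differences nonnegative. The upper bound for a planted witness is
  \<open>planted_noise_bound\<close>; for conditioning on the existence of a clique it is
  transferred by \<open>field_expectation_first_witness\<close>.\<close>

lemma clique_noise_bounds:
  fixes c \<epsilon> p :: real and k n :: nat
  defines "b \<equiv> real k * sqrt ((2 / c) ^ 3 * real k ^ 6 / real n) + exp (- (3 / 8 * \<epsilon> * real k))"
  assumes k: "2 \<le> k" "k \<le> n" and p: "p \<in> {0..1}" and \<epsilon>: "\<epsilon> \<in> {0..1}"
    and c: "0 < c" "c \<le> clique_prob n k p" "clique_prob n k p \<le> 1 - c"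
    and D: "(2 / c) ^ 3 * real k ^ 6 / real n \<le> 1 / 2"
      "real k * sqrt ((2 / c) ^ 3 * real k ^ 6 / real n) < 1"
  shows "\<bar>\<P>((\<omega>, \<omega>') in resample_pmf (potential_edges n) p \<epsilon>. has_clique n k \<omega>' \<bar> has_clique n k \<omega>)
            - clique_prob n k p\<bar> \<le> b" (is "\<bar>?A - ?P\<bar> \<le> b")
    and "\<bar>(MAX W\<in>one_witnesses (potential_edges n) (has_clique n k).
            \<P>((\<omega>, \<omega>') in resample_pmf (potential_edges n) p \<epsilon>. has_clique n k \<omega>' \<bar> \<forall>e\<in>W. \<omega> e))
            - clique_prob n k p\<bar> \<le> b" (is "\<bar>?B - ?P\<bar> \<le> b")
proof -
  let ?\<Lambda> = "potential_edges n" and ?N = "[{..<n}]\<^bsup>k\<^esup>"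
  let ?f = "\<lambda>\<omega>. of_bool (has_clique n k \<omega>) :: real"
  let ?T = "noise_operator ?\<Lambda> p \<epsilon> ?f" and ?E = "field_expectation ?\<Lambda> (\<lambda>_. p)"
  let ?W = "\<lambda>W. \<P>((\<omega>, \<omega>') in resample_pmf ?\<Lambda> p \<epsilon>. has_clique n k \<omega>' \<bar> \<forall>e\<in>W. \<omega> e)"
  have planted: "field_expectation ?\<Lambda> (plant ([S]\<^bsup>2\<^esup>) (\<lambda>_. p)) ?T \<le> ?P + b" if "S \<in> ?N" for S
    using planted_noise_bound[OF k p \<epsilon> c(1) _ c(3) D that] c by (simp add: b_def)
  have lower: "?P \<le> ?E (\<lambda>\<omega>. of_bool (Q \<omega>) * ?T \<omega>) / ?E (\<lambda>\<omega>. of_bool (Q \<omega>))"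
    if "mono (\<lambda>\<omega>. of_bool (Q \<omega>) :: real)" "0 < ?E (\<lambda>\<omega>. of_bool (Q \<omega>))" for Q
    using noise_correlation_ge[OF finite_potential_edges p \<epsilon> mono_of_bool_has_clique that(1), of n n k] that(2)
    unfolding clique_prob_def[symmetric] by (simp add: pos_le_divide_eq mult.commute)
  \<comment> \<open>At \<open>p = 0\<close> no clique could occur, contradicting the lower bound
    \<open>c\<close>. Positivity gives every witness event positive probability, so its quotient is
    not a division by zero.\<close>
  have p0: "0 < p"
  proof (rule ccontr)
    assume "\<not> 0 < p"
    then have p: "p = 0" using p by auto
    have "clique_prob n k p \<le> (\<Sum>S\<in>?N. ?E (\<lambda>\<omega>. of_bool (\<forall>e\<in>[S]\<^bsup>2\<^esup>. \<omega> e)))"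
    proof -
      have "?f \<omega> \<le> (\<Sum>S\<in>?N. of_bool (\<forall>e\<in>[S]\<^bsup>2\<^esup>. \<omega> e))" for \<omega>
      proof (cases "has_clique n k \<omega>")
        case True
        then obtain S where S: "S \<in> ?N" "\<forall>e\<in>[S]\<^bsup>2\<^esup>. \<omega> e" unfolding has_clique_iff by blast
        then show ?thesis
          using member_le_sum[of S ?N "\<lambda>S. of_bool (\<forall>e\<in>[S]\<^bsup>2\<^esup>. \<omega> e) :: real"] True
          by (simp add: finite_imp_finite_nsets)
      qed (auto intro: sum_nonneg)
      then have "clique_prob n k p \<le> ?E (\<lambda>\<omega>. \<Sum>S\<in>?N. of_bool (\<forall>e\<in>[S]\<^bsup>2\<^esup>. \<omega> e))"
        unfolding clique_prob_def by (intro field_expectation_mono) auto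
      then show ?thesis by (simp add: Bochner_Integration.integral_sum)
    qed
    also have "\<dots> = 0"
    proof (rule sum.neutral, rule ballI)
      fix S assume S: "S \<in> ?N"
      have "card S = k" using S by (simp add: nsets_def)
      then have "card ([S]\<^bsup>2\<^esup>) \<noteq> 0" using k by simp
      then show "?E (\<lambda>\<omega>. of_bool (\<forall>e\<in>[S]\<^bsup>2\<^esup>. \<omega> e)) = 0"
        using S p nsets_subset_potential_edges
        by (subst field_expectation_all) auto
    qed
    finally show False using c by simp
  qed
  have EP: "?E ?f = ?P" by (simp add: clique_prob_def)
  have "?P \<le> ?A"
    unfolding resample_cond_prob[OF finite_potential_edges]
    using c EP by (intro lower mono_of_bool_has_clique) simp
  moreover have "?A \<le> ?P + b"
  proof -
    have f: "has_clique n k \<omega> \<longleftrightarrow> (\<exists>W\<in>(\<lambda>S. [S]\<^bsup>2\<^esup>) ` ?N. \<forall>e\<in>W. \<omega> e)" for \<omega>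
      unfolding has_clique_iff by simp
    have "?E (\<lambda>\<omega>. of_bool (\<exists>W\<in>(\<lambda>S. [S]\<^bsup>2\<^esup>) ` ?N. \<forall>e\<in>W. \<omega> e) * ?T \<omega>) \<le>
       (?P + b) * ?E (\<lambda>\<omega>. of_bool (\<exists>W\<in>(\<lambda>S. [S]\<^bsup>2\<^esup>) ` ?N. \<forall>e\<in>W. \<omega> e))"
      using p planted
      by (intro field_expectation_first_witness mono_noise_operator mono_of_bool_has_clique)
        (auto simp: finite_imp_finite_nsets dest: subsetD[OF nsets_subset_potential_edges])
    then have "?E (\<lambda>\<omega>. ?f \<omega> * ?T \<omega>) \<le> (?P + b) * ?E ?f" unfolding f[symmetric] .
    then show ?thesis
      unfolding resample_cond_prob[OF finite_potential_edges]
      using c EP by (simp add: pos_divide_le_eq)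
  qed
  ultimately show "\<bar>?A - ?P\<bar> \<le> b" by linarith
  have W: "?P \<le> ?W ([S]\<^bsup>2\<^esup>) \<and> ?W ([S]\<^bsup>2\<^esup>) \<le> ?P + b" if S: "S \<in> ?N" for S
  proof -
    have pr: "?E (\<lambda>\<omega>. of_bool (\<forall>e\<in>[S]\<^bsup>2\<^esup>. \<omega> e)) = (\<Prod>e\<in>[S]\<^bsup>2\<^esup>. p)"
      using p by (intro field_expectation_all nsets_subset_potential_edges[OF S]) auto
    have pos: "0 < (\<Prod>e\<in>[S]\<^bsup>2\<^esup>. p)" using p0 by (intro prod_pos)
    have mono: "mono (\<lambda>\<omega>. of_bool (\<forall>e\<in>[S]\<^bsup>2\<^esup>. \<omega> e) :: real)"
      by (intro monoI) (auto simp: of_bool_def le_fun_def)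
    have "?E (\<lambda>\<omega>. of_bool (\<forall>e\<in>[S]\<^bsup>2\<^esup>. \<omega> e) * ?T \<omega>) =
       (\<Prod>e\<in>[S]\<^bsup>2\<^esup>. p) * field_expectation ?\<Lambda> (plant ([S]\<^bsup>2\<^esup>) (\<lambda>_. p)) ?T"
      using p by (intro field_expectation_condition nsets_subset_potential_edges[OF S]) auto
    then have "?W ([S]\<^bsup>2\<^esup>) = field_expectation ?\<Lambda> (plant ([S]\<^bsup>2\<^esup>) (\<lambda>_. p)) ?T"
      unfolding resample_cond_prob[OF finite_potential_edges] pr using p0 by simp
    moreover have "?P \<le> ?W ([S]\<^bsup>2\<^esup>)"
      unfolding resample_cond_prob[OF finite_potential_edges]
      by (intro lower mono) (use pr pos in simp)
    ultimately show ?thesis using planted[OF S] by simp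
  qed
  have "finite ?N" by (simp add: finite_imp_finite_nsets)
  \<comment> \<open>Ensures that \<open>Max\<close> is taken over a nonempty set.\<close>
  moreover have "?N \<noteq> {}" using k by (simp add: nsets_eq_empty_iff)
  ultimately have "?P \<le> ?B \<and> ?B \<le> ?P + b"
    unfolding one_witnesses_has_clique[OF k(1)] image_image using W
    by (simp add: Max_ge_iff Max_le_iff del: nsets_eq_empty_iff) blast
  then show "\<bar>?B - ?P\<bar> \<le> b" by linarith
qed

section \<open>Passage to the limit\<close>

theorem theorem1p5:
  fixes k :: "nat \<Rightarrow> nat" and p :: "nat \<Rightarrow> real"
  assumes k_subpoly: "\<exists>\<delta> :: nat \<Rightarrow> real. \<delta> \<in> o(\<lambda>_. 1) \<and>
             (\<forall>\<^sub>F n in sequentially. real (k n) = real n powr \<delta> n)"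
    and k_at_top: "filterlim k at_top sequentially"
    and p_prob: "\<forall>n. p n \<in> {0..1}"
    and nondeg: "nondegenerate potential_edges p (\<lambda>n. has_clique n (k n))"
  shows "noise_sensitive potential_edges p (\<lambda>n. has_clique n (k n)) \<and>
         one_strongly_noise_sensitive potential_edges p (\<lambda>n. has_clique n (k n))"
proof -
  have prob: "\<P>(\<omega> in config_pmf (potential_edges n) (p n). has_clique n (k n) \<omega>) = clique_prob n (k n) (p n)" for n
    unfolding config_pmf_eq_field clique_prob_def by (rule field_prob)
  obtain c where c: "0 < c" "\<forall>\<^sub>F n in sequentially. c \<le> clique_prob n (k n) (p n) \<and> clique_prob n (k n) (p n) \<le> 1 - c"
    using nondeg unfolding nondegenerate_def prob by auto
  have lim: "(\<lambda>n. real (k n) ^ m / real n) \<longlonglongrightarrow> 0" for m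
    using k_subpoly subpolynomial_power_over_n by blast
  define D where "D n = (2 / c) ^ 3 * real (k n) ^ 6 / real n" for n
  define e where "e n = real (k n) * sqrt (D n)" for n
  have D0: "D \<longlonglongrightarrow> 0"
    using tendsto_mult_left[OF lim[of 6], of "(2 / c) ^ 3"] by (simp add: D_def[abs_def])
  \<comment> \<open>Pulling \<open>k n\<close> under the root raises the power of \<open>k n\<close>
    from 6 to 8, so the limit for \<open>m = 8\<close> applies.\<close>
  have e_eq: "e n = sqrt ((2 / c) ^ 3 * (real (k n) ^ 8 / real n))" for n
  proof -
    have "e n = sqrt ((real (k n))\<^sup>2 * D n)" by (simp add: e_def real_sqrt_mult)
    also have "(real (k n))\<^sup>2 * D n = (2 / c) ^ 3 * (real (k n) ^ 8 / real n)"
      by (simp add: D_def eval_nat_numeral)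
    finally show ?thesis .
  qed
  have e0: "e \<longlonglongrightarrow> 0"
    using tendsto_real_sqrt[OF tendsto_mult_left[OF lim[of 8], of "(2 / c) ^ 3"]]
    by (simp add: e_eq[abs_def])
  have le: "\<forall>\<^sub>F n in sequentially. k n \<le> n"
    using order_tendstoD(2)[OF lim[of 1] zero_less_one] eventually_gt_at_top[of 0]
    by eventually_elim (simp add: divide_less_eq)
  \<comment> \<open>Eventually all hypotheses of \<open>clique_noise_bounds\<close> hold at
    once.\<close>
  have good: "\<forall>\<^sub>F n in sequentially. 2 \<le> k n \<and> k n \<le> n \<and> c \<le> clique_prob n (k n) (p n) \<and>
      clique_prob n (k n) (p n) \<le> 1 - c \<and> D n \<le> 1 / 2 \<and> e n < 1"
    using k_at_top[unfolded filterlim_at_top, rule_format, of 2] le c(2)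
      order_tendstoD(2)[OF D0 half_gt_zero[OF zero_less_one]] order_tendstoD(2)[OF e0 zero_less_one]
    by eventually_elim auto
  have main: "(\<lambda>n. \<P>((\<omega>, \<omega>') in resample_pmf (potential_edges n) (p n) \<epsilon>. has_clique n (k n) \<omega>' \<bar> has_clique n (k n) \<omega>)
      - clique_prob n (k n) (p n)) \<longlonglongrightarrow> 0 \<and>
    (\<lambda>n. (MAX W\<in>one_witnesses (potential_edges n) (has_clique n (k n)).
      \<P>((\<omega>, \<omega>') in resample_pmf (potential_edges n) (p n) \<epsilon>. has_clique n (k n) \<omega>' \<bar> \<forall>e\<in>W. \<omega> e))
      - clique_prob n (k n) (p n)) \<longlonglongrightarrow> 0" (is "?A \<longlonglongrightarrow> 0 \<and> ?B \<longlonglongrightarrow> 0")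
    if \<epsilon>: "\<epsilon> \<in> {0<..<1}" for \<epsilon>
  proof -
    define b where "b n = e n + exp (- (3 / 8 * \<epsilon> * real (k n)))" for n
    have "filterlim (\<lambda>n. real (k n)) at_top sequentially"
      using k_at_top by (rule filterlim_compose[OF filterlim_real_sequentially])
    then have "filterlim (\<lambda>n. 3 / 8 * \<epsilon> * real (k n)) at_top sequentially"
      using \<epsilon> by (intro filterlim_tendsto_pos_mult_at_top[OF tendsto_const]) auto
    then have "(\<lambda>n. exp (- (3 / 8 * \<epsilon> * real (k n)))) \<longlonglongrightarrow> 0"
      by (intro filterlim_compose[OF exp_at_bot] filterlim_compose[OF filterlim_uminus_at_bot_at_top])
    then have b0: "b \<longlonglongrightarrow> 0" unfolding b_def[abs_def] using tendsto_add[OF e0] by fastforce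
    have bounds: "\<forall>\<^sub>F n in sequentially. norm (?A n) \<le> b n \<and> norm (?B n) \<le> b n"
      using good
    proof eventually_elim
      case (elim n)
      then show ?case
        unfolding real_norm_def b_def e_def D_def
        using c(1) p_prob \<epsilon> by (intro conjI clique_noise_bounds) auto
    qed
    show ?thesis
      by (intro conjI Lim_null_comparison[OF _ b0] eventually_mono[OF bounds]) (erule conjunct1 conjunct2)+
  qed
  then show ?thesis
    unfolding noise_sensitive_def one_strongly_noise_sensitive_def prob by blast
qed

end
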